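(* The Kleisli categories $\mathrm{Kl}(\mathsf D)$ and $\mathrm{Kl}(\tilde{\mathsf D})$ of the subdistribution monads on $\mathbf{Set}$ and on $\mathbf{pSet}$ are respectively equivalent to the categories $\mathbf{subMat}$ and $\mathbf{psubMat}$. The monoidal structures on the Kleisli categories transfer to monoidal structures on $\mathbf{subMat}$ and $\mathbf{psubMat}$ whose monoidal product is given (on morphisms) by the Kronecker product and whose monoidal unit is the one-point set $\mathbf 1$, the terminal object of $\mathbf{Set}$, respectively of $\mathbf{pSet}$.
   Context: A subdistribution on a set $X$ is a finitely supported function $p\colon X\to[0,1]$ with $\sum_xp_x\le1$; $\delta_x$ is the unit distribution at $x$. A subdistribution matrix of shape $(X,Y)$ is a function $M\colon X\times Y\to[0,1]$ all of whose rows $M_{x,-}$ are subdistributions on $Y$. Products: $(MN)_{x,z}=\sum_yM_{x,y}N_{y,z}$, $(pM)_y=\sum_xp_xM_{x,y}$; Kronecker product: $(M\otimes N)_{(x,u),(y,v)}=M_{x,y}N_{u,v}$. A partitioned set $(X,\sim)$ is a set with an equivalence relation; $\mathbf{pSet}$ is the category of partitioned sets and functions respecting the equivalence relations; its products have $(x,y)\sim(x',y')$ iff $x\sim x'$ and $y\sim y'$. Subdistributions $p,q$ on a partitioned set $(X,\sim)$ are equivalent, $p\sim q$, if $\sum_{x'\in[x]}p_{x'}=\sum_{x'\in[x]}q_{x'}$ for all $x\in X$. A subdistribution matrix $M$ of shape $(X,Y)$ between partitioned sets is partitioned if $p\sim q$ implies $pM\sim qM$ for all subdistributions $p,q$ on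 $X$. $\mathbf{subMat}$: objects sets, morphisms $X\to Y$ subdistribution matrices of shape $(X,Y)$. $\mathbf{psubMat}$: objects partitioned sets, morphisms $(X,\sim)\to(Y,\sim)$ partitioned subdistribution matrices of shape $(X,Y)$. In both, composition is matrix multiplication (diagrammatic order). $\mathsf D\colon\mathbf{Set}\to\mathbf{Set}$ sends $X$ to the set of subdistributions on $X$ and $f\colon X\to Y$ to $p\mapsto\big(y\mapsto\sum_{x\in f^{-1}(y)}p_x\big)$; it is a monad with unit $x\mapsto\delta_x$ and multiplication $\mu_X(\sigma)_x=\sum_{p\in\mathsf DX}\sigma(p)p_x$, monoidal (for the cartesian product) via $t_{X,Y}(\sigma,\tau)(x,y)=\sigma(x)\tau(y)$ and $u\colon\mathbf 1\to\mathsf D\mathbf 1$ picking the unique distribution. $\tilde{\mathsf D}$ is the monoidal monad on $\mathbf{pSet}$ sending $(X,\sim)$ to $\mathsf DX$ with the relation of equivalence of subdistributions, with all structure maps given by the same underlying functions. The Kleisli category $\mathrm{Kl}(T)$ of a monad $T$ on $\mathbb C$ has the objects of $\mathbb C$, morphisms $x\to y$ the morphisms $x\to Ty$ of $\mathbb C$, identities the unit, and composite of $(f,g)$ equal to $f$ followed by $T(g)$ followed by $\mu$. The monoidal structures on $\mathrm{Kl}(\mathsf D)$ and $\mathrm{Kl}(\tilde{\mathsf D})$ are the cartesian product on objects and, for Kleisli morphisms $f\colon X\to Y$, $f'\colon X'\to Y'$, $f\otimes f'$ is $f\times f'$ followed by $t_{Y,Y'}$; the unit is $\mathbf 1$. 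*)

theory Defs
  imports Complex_Main "HOL-Library.FuncSet" "HOL-Library.Nat_Bijection"
begin

section \<open>Categories\<close>

text \<open>Composition \<open>Cmp C f g\<close> is in diagrammatic order: first \<open>f\<close>, then \<open>g\<close>.\<close>

record ('o, 'm) cat_data =
  Ob :: "'o set"
  Ar :: "'m set"
  Dom :: "'m \<Rightarrow> 'o"
  Cod :: "'m \<Rightarrow> 'o"
  Id :: "'o \<Rightarrow> 'm"
  Cmp :: "'m \<Rightarrow> 'm \<Rightarrow> 'm"

definition hom :: "('o, 'm) cat_data \<Rightarrow> 'o \<Rightarrow> 'o \<Rightarrow> 'm set" where
  "hom C x y = {f \<in> Ar C. Dom C f = x \<and> Cod C f = y}"

locale category =
  fixes C :: "('o, 'm) cat_data"
  assumes Dom_Ob: "f \<in> Ar C \<Longrightarrow> Dom C f \<in> Ob C"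
    and Cod_Ob: "f \<in> Ar C \<Longrightarrow> Cod C f \<in> Ob C"
    and Id_hom: "x \<in> Ob C \<Longrightarrow> Id C x \<in> hom C x x"
    and Cmp_hom: "\<lbrakk>f \<in> hom C x y; g \<in> hom C y z\<rbrakk> \<Longrightarrow> Cmp C f g \<in> hom C x z"
    and Id_left: "f \<in> hom C x y \<Longrightarrow> Cmp C (Id C x) f = f"
    and Id_right: "f \<in> hom C x y \<Longrightarrow> Cmp C f (Id C y) = f"
    and Cmp_assoc: "\<lbrakk>f \<in> hom C w x; g \<in> hom C x y; h \<in> hom C y z\<rbrakk>
        \<Longrightarrow> Cmp C (Cmp C f g) h = Cmp C f (Cmp C g h)"

definition iso_in :: "('o, 'm) cat_data \<Rightarrow> 'o \<Rightarrow> 'o \<Rightarrow> 'm \<Rightarrow> bool" where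
  "iso_in C x y f \<longleftrightarrow> f \<in> hom C x y \<and>
     (\<exists>g \<in> hom C y x. Cmp C f g = Id C x \<and> Cmp C g f = Id C y)"

definition terminal_in :: "('o, 'm) cat_data \<Rightarrow> 'o \<Rightarrow> bool" where
  "terminal_in C t \<longleftrightarrow> t \<in> Ob C \<and> (\<forall>x \<in> Ob C. \<exists>!f. f \<in> hom C x t)"

record ('o1, 'm1, 'o2, 'm2) functor_data =
  fob :: "'o1 \<Rightarrow> 'o2"
  far :: "'m1 \<Rightarrow> 'm2"

locale is_functor = source: category C + target: category D
  for C :: "('o1, 'm1) cat_data" and D :: "('o2, 'm2) cat_data" +
  fixes F :: "('o1, 'm1, 'o2, 'm2) functor_data"
  assumes fob_Ob: "x \<in> Ob C \<Longrightarrow> fob F x \<in> Ob D"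
    and far_hom: "f \<in> hom C x y \<Longrightarrow> far F f \<in> hom D (fob F x) (fob F y)"
    and far_Id: "x \<in> Ob C \<Longrightarrow> far F (Id C x) = Id D (fob F x)"
    and far_Cmp: "\<lbrakk>f \<in> hom C x y; g \<in> hom C y z\<rbrakk>
        \<Longrightarrow> far F (Cmp C f g) = Cmp D (far F f) (far F g)"

definition id_functor :: "('o, 'm, 'o, 'm) functor_data" where
  "id_functor = \<lparr>fob = (\<lambda>x. x), far = (\<lambda>f. f)\<rparr>"

text \<open>First \<open>F\<close>, then \<open>G\<close>.\<close>

definition comp_functor ::
  "('o1, 'm1, 'o2, 'm2) functor_data \<Rightarrow> ('o2, 'm2, 'o3, 'm3) functor_data
     \<Rightarrow> ('o1, 'm1, 'o3, 'm3) functor_data" where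
  "comp_functor F G = \<lparr>fob = (\<lambda>x. fob G (fob F x)), far = (\<lambda>f. far G (far F f))\<rparr>"

locale natural_iso = F: is_functor C D F + G: is_functor C D G
  for C :: "('o1, 'm1) cat_data" and D :: "('o2, 'm2) cat_data"
    and F G :: "('o1, 'm1, 'o2, 'm2) functor_data" +
  fixes \<tau> :: "'o1 \<Rightarrow> 'm2"
  assumes component_iso: "x \<in> Ob C \<Longrightarrow> iso_in D (fob F x) (fob G x) (\<tau> x)"
    and natural: "f \<in> hom C x y \<Longrightarrow> Cmp D (far F f) (\<tau> y) = Cmp D (\<tau> x) (far G f)"

locale equivalence = F: is_functor C D F + G: is_functor D C G
    + unit: natural_iso C C id_functor "comp_functor F G" \<eta>
    + counit: natural_iso D D "comp_functor G F" id_functor \<epsilon>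
  for C :: "('o1, 'm1) cat_data" and D :: "('o2, 'm2) cat_data"
    and F :: "('o1, 'm1, 'o2, 'm2) functor_data"
    and G :: "('o2, 'm2, 'o1, 'm1) functor_data"
    and \<eta> :: "'o1 \<Rightarrow> 'm1" and \<epsilon> :: "'o2 \<Rightarrow> 'm2"


section \<open>Monoidal categories\<close>

record ('o, 'm) tensor_data =
  tob :: "'o \<Rightarrow> 'o \<Rightarrow> 'o"
  tar :: "'m \<Rightarrow> 'm \<Rightarrow> 'm"
  tunit :: 'o
  tassoc :: "'o \<Rightarrow> 'o \<Rightarrow> 'o \<Rightarrow> 'm"
  tleft :: "'o \<Rightarrow> 'm"
  tright :: "'o \<Rightarrow> 'm"

locale monoidal_category = category C
  for C :: "('o, 'm) cat_data" +
  fixes T :: "('o, 'm) tensor_data"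
  assumes tob_Ob: "\<lbrakk>x \<in> Ob C; y \<in> Ob C\<rbrakk> \<Longrightarrow> tob T x y \<in> Ob C"
    and tar_hom: "\<lbrakk>f \<in> hom C x y; f' \<in> hom C x' y'\<rbrakk>
        \<Longrightarrow> tar T f f' \<in> hom C (tob T x x') (tob T y y')"
    and tar_Id: "\<lbrakk>x \<in> Ob C; y \<in> Ob C\<rbrakk> \<Longrightarrow> tar T (Id C x) (Id C y) = Id C (tob T x y)"
    and tar_Cmp: "\<lbrakk>f \<in> hom C x y; g \<in> hom C y z; f' \<in> hom C x' y'; g' \<in> hom C y' z'\<rbrakk>
        \<Longrightarrow> tar T (Cmp C f g) (Cmp C f' g') = Cmp C (tar T f f') (tar T g g')"
    and tunit_Ob: "tunit T \<in> Ob C"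
    and tassoc_iso: "\<lbrakk>x \<in> Ob C; y \<in> Ob C; z \<in> Ob C\<rbrakk>
        \<Longrightarrow> iso_in C (tob T (tob T x y) z) (tob T x (tob T y z)) (tassoc T x y z)"
    and tleft_iso: "x \<in> Ob C \<Longrightarrow> iso_in C (tob T (tunit T) x) x (tleft T x)"
    and tright_iso: "x \<in> Ob C \<Longrightarrow> iso_in C (tob T x (tunit T)) x (tright T x)"
    and tassoc_natural: "\<lbrakk>f \<in> hom C x x'; g \<in> hom C y y'; h \<in> hom C z z'\<rbrakk>
        \<Longrightarrow> Cmp C (tar T (tar T f g) h) (tassoc T x' y' z')
          = Cmp C (tassoc T x y z) (tar T f (tar T g h))"
    and tleft_natural: "f \<in> hom C x y
        \<Longrightarrow> Cmp C (tar T (Id C (tunit T)) f) (tleft T y) = Cmp C (tleft T x) f"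
    and tright_natural: "f \<in> hom C x y
        \<Longrightarrow> Cmp C (tar T f (Id C (tunit T))) (tright T y) = Cmp C (tright T x) f"
    and pentagon: "\<lbrakk>w \<in> Ob C; x \<in> Ob C; y \<in> Ob C; z \<in> Ob C\<rbrakk>
        \<Longrightarrow> Cmp C (tassoc T (tob T w x) y z) (tassoc T w x (tob T y z))
          = Cmp C (Cmp C (tar T (tassoc T w x y) (Id C z)) (tassoc T w (tob T x y) z))
                  (tar T (Id C w) (tassoc T x y z))"
    and triangle: "\<lbrakk>x \<in> Ob C; y \<in> Ob C\<rbrakk>
        \<Longrightarrow> Cmp C (tassoc T x (tunit T) y) (tar T (Id C x) (tleft T y))
          = tar T (tright T x) (Id C y)"

locale strong_monoidal_functor =
    M: monoidal_category C S + N: monoidal_category D T + is_functor C D F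
  for C :: "('o1, 'm1) cat_data" and S :: "('o1, 'm1) tensor_data"
    and D :: "('o2, 'm2) cat_data" and T :: "('o2, 'm2) tensor_data"
    and F :: "('o1, 'm1, 'o2, 'm2) functor_data" +
  fixes \<phi> :: "'o1 \<Rightarrow> 'o1 \<Rightarrow> 'm2" and \<iota> :: "'m2"
  assumes \<phi>_iso: "\<lbrakk>x \<in> Ob C; y \<in> Ob C\<rbrakk>
        \<Longrightarrow> iso_in D (tob T (fob F x) (fob F y)) (fob F (tob S x y)) (\<phi> x y)"
    and \<phi>_natural: "\<lbrakk>f \<in> hom C x y; f' \<in> hom C x' y'\<rbrakk>
        \<Longrightarrow> Cmp D (tar T (far F f) (far F f')) (\<phi> y y') = Cmp D (\<phi> x x') (far F (tar S f f'))"
    and \<iota>_iso: "iso_in D (tunit T) (fob F (tunit S)) \<iota>"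
    and \<phi>_assoc: "\<lbrakk>x \<in> Ob C; y \<in> Ob C; z \<in> Ob C\<rbrakk>
        \<Longrightarrow> Cmp D (Cmp D (tar T (\<phi> x y) (Id D (fob F z))) (\<phi> (tob S x y) z)) (far F (tassoc S x y z))
          = Cmp D (Cmp D (tassoc T (fob F x) (fob F y) (fob F z)) (tar T (Id D (fob F x)) (\<phi> y z)))
                  (\<phi> x (tob S y z))"
    and \<phi>_left: "x \<in> Ob C
        \<Longrightarrow> Cmp D (Cmp D (tar T \<iota> (Id D (fob F x))) (\<phi> (tunit S) x)) (far F (tleft S x))
          = tleft T (fob F x)"
    and \<phi>_right: "x \<in> Ob C
        \<Longrightarrow> Cmp D (Cmp D (tar T (Id D (fob F x)) \<iota>) (\<phi> x (tunit S))) (far F (tright S x))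
          = tright T (fob F x)"


section \<open>Kleisli categories\<close>

text \<open>
  The field \<open>mstr\<close> is the binary part \<open>t\<close> of a monoidal structure on the functor; its nullary
  part \<open>u\<close> does not enter the Kleisli category or its tensor product.
\<close>

record ('o, 'm) monad_data = "('o, 'm, 'o, 'm) functor_data" +
  munit :: "'o \<Rightarrow> 'm"
  mmult :: "'o \<Rightarrow> 'm"
  mstr :: "'o \<Rightarrow> 'o \<Rightarrow> 'm"

text \<open>
  A Kleisli morphism \<open>x \<rightarrow> y\<close> is a pair \<open>(f, y)\<close> with \<open>f : x \<rightarrow> T y\<close>; \<open>y\<close> is recorded because it
  need not be determined by \<open>T y\<close>.
\<close>

definition Kleisli :: "('o, 'm) cat_data \<Rightarrow> ('o, 'm) monad_data \<Rightarrow> ('o, 'm \<times> 'o) cat_data" where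
  "Kleisli C T = \<lparr>
     Ob = Ob C,
     Ar = {(f, y). f \<in> Ar C \<and> y \<in> Ob C \<and> Cod C f = fob T y},
     Dom = (\<lambda>(f, y). Dom C f),
     Cod = (\<lambda>(f, y). y),
     Id = (\<lambda>x. (munit T x, x)),
     Cmp = (\<lambda>(f, y) (g, z). (Cmp C (Cmp C f (far T g)) (mmult T z), z))\<rparr>"

text \<open>The constraints are the images of those of \<open>C\<close> under the canonical functor to the Kleisli category.\<close>

definition Kleisli_tensor ::
  "('o, 'm) cat_data \<Rightarrow> ('o, 'm) tensor_data \<Rightarrow> ('o, 'm) monad_data
     \<Rightarrow> ('o, 'm \<times> 'o) tensor_data" where
  "Kleisli_tensor C S T = \<lparr>
     tob = tob S,
     tar = (\<lambda>(f, y) (f', y'). (Cmp C (tar S f f') (mstr T y y'), tob S y y')),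
     tunit = tunit S,
     tassoc = (\<lambda>x y z. let w = tob S x (tob S y z) in (Cmp C (tassoc S x y z) (munit T w), w)),
     tleft = (\<lambda>x. (Cmp C (tleft S x) (munit T x), x)),
     tright = (\<lambda>x. (Cmp C (tright S x) (munit T x), x))\<rparr>"


section \<open>Subdistributions and matrices\<close>

text \<open>
  Functions on a set \<open>X\<close> (and matrices of shape \<open>(X, Y)\<close>) with values in \<open>[0,1]\<close> are represented by
  their extensions by zero. Sums are taken over the finite supports of the subdistributions
  involved, since \<open>sum\<close> over an infinite index set is zero by convention.
\<close>

definition supp :: "('u \<Rightarrow> real) \<Rightarrow> 'u set" where
  "supp p = {x. p x \<noteq> 0}"

definition subdist :: "'u set \<Rightarrow> ('u \<Rightarrow> real) set" where
  "subdist X = {p. finite (supp p) \<and> supp p \<subseteq> X \<and> (\<forall>x. 0 \<le> p x \<and> p x \<le> 1) \<and> sum p (supp p) \<le> 1}"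

definition dirac :: "'u \<Rightarrow> 'u \<Rightarrow> real" where
  "dirac x = (\<lambda>y. if y = x then 1 else 0)"

definition submat :: "'u set \<Rightarrow> 'u set \<Rightarrow> ('u \<Rightarrow> 'u \<Rightarrow> real) set" where
  "submat X Y = {M. (\<forall>x\<in>X. M x \<in> subdist Y) \<and> (\<forall>x. x \<notin> X \<longrightarrow> M x = (\<lambda>_. 0))}"

definition vec_mat :: "('u \<Rightarrow> real) \<Rightarrow> ('u \<Rightarrow> 'u \<Rightarrow> real) \<Rightarrow> 'u \<Rightarrow> real" where
  "vec_mat p M = (\<lambda>y. \<Sum>x\<in>supp p. p x * M x y)"

definition mat_mult :: "('u \<Rightarrow> 'u \<Rightarrow> real) \<Rightarrow> ('u \<Rightarrow> 'u \<Rightarrow> real) \<Rightarrow> 'u \<Rightarrow> 'u \<Rightarrow> real" where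
  "mat_mult M N = (\<lambda>x z. \<Sum>y\<in>supp (M x). M x y * N y z)"

definition mat_id :: "'u set \<Rightarrow> 'u \<Rightarrow> 'u \<Rightarrow> real" where
  "mat_id X = (\<lambda>x y. if x \<in> X \<and> x = y then 1 else 0)"

text \<open>A partitioned set is a pair \<open>(X, R)\<close> with \<open>equiv X R\<close>.\<close>

type_synonym 'u pset = "'u set \<times> 'u rel"

definition sub_equiv :: "'u pset \<Rightarrow> ('u \<Rightarrow> real) \<Rightarrow> ('u \<Rightarrow> real) \<Rightarrow> bool" where
  "sub_equiv A p q \<longleftrightarrow>
     (\<forall>x\<in>fst A. (\<Sum>x'\<in>supp p \<inter> snd A `` {x}. p x') = (\<Sum>x'\<in>supp q \<inter> snd A `` {x}. q x'))"

definition partitioned :: "'u pset \<Rightarrow> 'u pset \<Rightarrow> ('u \<Rightarrow> 'u \<Rightarrow> real) \<Rightarrow> bool" where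
  "partitioned A B M \<longleftrightarrow>
     (\<forall>p\<in>subdist (fst A). \<forall>q\<in>subdist (fst A).
        sub_equiv A p q \<longrightarrow> sub_equiv B (vec_mat p M) (vec_mat q M))"


section \<open>Universes of sets\<close>

text \<open>
  HOL has no type of all sets. The category of sets is therefore taken relative to a universe: a
  family \<open>usets\<close> of subsets of a type \<open>'u\<close>, containing a singleton and closed under binary products
  and under passing from \<open>X\<close> to the set of subdistributions on \<open>X\<close>. Pairs and subdistributions are
  represented as elements of \<open>'u\<close> by injective encodings \<open>upair\<close> and \<open>udist\<close>.
\<close>

record 'u universe =
  usets :: "'u set set"
  upoint :: 'u
  upair :: "'u \<times> 'u \<Rightarrow> 'u"
  udist :: "('u \<Rightarrow> real) \<Rightarrow> 'u"

definition uprod :: "'u universe \<Rightarrow> 'u set \<Rightarrow> 'u set \<Rightarrow> 'u set" where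
  "uprod V X Y = upair V ` (X \<times> Y)"

definition usubdist :: "'u universe \<Rightarrow> 'u set \<Rightarrow> 'u set" where
  "usubdist V X = udist V ` subdist X"

locale set_universe =
  fixes V :: "'u universe"
  assumes upair_inj: "inj (upair V)"
    and udist_inj: "inj_on (udist V) (subdist UNIV)"
    and upoint_usets: "{upoint V} \<in> usets V"
    and uprod_usets: "\<lbrakk>X \<in> usets V; Y \<in> usets V\<rbrakk> \<Longrightarrow> uprod V X Y \<in> usets V"
    and usubdist_usets: "X \<in> usets V \<Longrightarrow> usubdist V X \<in> usets V"

definition ufst :: "'u universe \<Rightarrow> 'u \<Rightarrow> 'u" where
  "ufst V w = fst (inv (upair V) w)"

definition usnd :: "'u universe \<Rightarrow> 'u \<Rightarrow> 'u" where
  "usnd V w = snd (inv (upair V) w)"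

definition the_dist :: "'u universe \<Rightarrow> 'u \<Rightarrow> 'u \<Rightarrow> real" where
  "the_dist V = inv_into (subdist UNIV) (udist V)"

definition uprod_rel :: "'u universe \<Rightarrow> 'u rel \<Rightarrow> 'u rel \<Rightarrow> 'u rel" where
  "uprod_rel V R S = {(upair V (x, y), upair V (x', y')) | x y x' y'. (x, x') \<in> R \<and> (y, y') \<in> S}"

definition pprod :: "'u universe \<Rightarrow> 'u pset \<Rightarrow> 'u pset \<Rightarrow> 'u pset" where
  "pprod V A B = (uprod V (fst A) (fst B), uprod_rel V (snd A) (snd B))"

definition psubdist :: "'u universe \<Rightarrow> 'u pset \<Rightarrow> 'u pset" where
  "psubdist V A =
     (usubdist V (fst A),
      {(udist V p, udist V q) | p q. p \<in> subdist (fst A) \<and> q \<in> subdist (fst A) \<and> sub_equiv A p q})"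

definition kron :: "'u universe \<Rightarrow> ('u \<Rightarrow> 'u \<Rightarrow> real) \<Rightarrow> ('u \<Rightarrow> 'u \<Rightarrow> real) \<Rightarrow> 'u \<Rightarrow> 'u \<Rightarrow> real" where
  "kron V M N = (\<lambda>w z. if w \<in> range (upair V) \<and> z \<in> range (upair V)
     then M (ufst V w) (ufst V z) * N (usnd V w) (usnd V z) else 0)"

text \<open>
  Universes exist. For instance, finite lists over \<open>nat \<Rightarrow> real\<close> embed into \<open>nat \<Rightarrow> real\<close>, so all
  subsets of this type form one.
\<close>

definition code_list :: "(nat \<Rightarrow> real) list \<Rightarrow> nat \<Rightarrow> real" where
  "code_list xs n = (case prod_decode n of (i, j) \<Rightarrow>
     case i of 0 \<Rightarrow> real (length xs) | Suc k \<Rightarrow> if k < length xs then (xs ! k) j else 0)"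

lemma inj_code_list: "inj code_list"
proof (rule injI)
  fix xs ys assume eq: "code_list xs = code_list ys"
  have len: "length xs = length ys"
    using fun_cong[OF eq, of "prod_encode (0, 0)"] by (simp add: code_list_def)
  show "xs = ys"
  proof (rule nth_equalityI[OF len])
    fix k assume k: "k < length xs"
    show "xs ! k = ys ! k"
    proof
      fix j
      show "(xs ! k) j = (ys ! k) j"
        using fun_cong[OF eq, of "prod_encode (Suc k, j)"] k len by (simp add: code_list_def)
    qed
  qed
qed

definition code_dist :: "((nat \<Rightarrow> real) \<Rightarrow> real) \<Rightarrow> nat \<Rightarrow> real" where
  "code_dist p = code_list (map (\<lambda>x. case_nat (p x) x) (SOME xs. set xs = supp p))"

lemma inj_code_dist: "inj_on code_dist (subdist UNIV)"
proof (rule inj_onI)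
  fix p q :: "(nat \<Rightarrow> real) \<Rightarrow> real"
  assume p: "p \<in> subdist UNIV" and q: "q \<in> subdist UNIV" and eq: "code_dist p = code_dist q"
  have some_list: "set (SOME xs. set xs = A) = A" if "finite A" for A :: "(nat \<Rightarrow> real) set"
    using finite_list[OF that] by (rule someI_ex)
  have set_p: "set (SOME xs. set xs = supp p) = supp p"
    and set_q: "set (SOME xs. set xs = supp q) = supp q"
    using p q by (simp_all add: subdist_def some_list)
  have "map (\<lambda>x. case_nat (p x) x) (SOME xs. set xs = supp p)
      = map (\<lambda>x. case_nat (q x) x) (SOME xs. set xs = supp q)"
    using eq by (simp add: code_dist_def inj_eq[OF inj_code_list])
  from arg_cong[OF this, of set]
  have img: "(\<lambda>x. case_nat (p x) x) ` supp p = (\<lambda>x. case_nat (q x) x) ` supp q"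
    by (simp add: set_p set_q)
  have inj: "a = b \<and> x = y"
    if "(case_nat a x :: nat \<Rightarrow> real) = case_nat b y" for a b :: real and x y :: "nat \<Rightarrow> real"
  proof
    show "a = b" using fun_cong[OF that, of 0] by simp
    show "x = y"
    proof
      fix n show "x n = y n" using fun_cong[OF that, of "Suc n"] by simp
    qed
  qed
  have 1: "p x = q x" if "x \<in> supp p" for x
  proof -
    have "case_nat (p x) x \<in> (\<lambda>x. case_nat (q x) x) ` supp q" using that img by blast
    then obtain y where "case_nat (p x) x = case_nat (q y) y" by blast
    from inj[OF this] show ?thesis by auto
  qed
  have 2: "p x = q x" if "x \<in> supp q" for x
  proof -
    have "case_nat (q x) x \<in> (\<lambda>x. case_nat (p x) x) ` supp p" using that img by blast
    then obtain y where "case_nat (q x) x = case_nat (p y) y" by blast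
    from inj[OF this] show ?thesis by auto
  qed
  show "p = q"
  proof
    fix x show "p x = q x" using 1[of x] 2[of x] by (cases "p x = 0"; cases "q x = 0") (simp_all add: supp_def)
  qed
qed

lemma set_universe_exists:
  "set_universe \<lparr>usets = UNIV, upoint = (\<lambda>_. 0), upair = (\<lambda>(x, y). code_list [x, y]), udist = code_dist\<rparr>"
  by unfold_locales (auto simp: inj_code_dist inj_eq[OF inj_code_list] intro!: injI)


section \<open>The categories\<close>

datatype ('o, 'f) arrow = Arrow (asrc: 'o) (amap: 'f) (atgt: 'o)

definition Set_cat :: "'u universe \<Rightarrow> ('u set, ('u set, 'u \<Rightarrow> 'u) arrow) cat_data" where
  "Set_cat V = \<lparr>
     Ob = usets V,
     Ar = {Arrow X f Y | X f Y. X \<in> usets V \<and> Y \<in> usets V \<and> f \<in> X \<rightarrow>\<^sub>E Y},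
     Dom = asrc, Cod = atgt,
     Id = (\<lambda>X. Arrow X (\<lambda>x\<in>X. x) X),
     Cmp = (\<lambda>a b. Arrow (asrc a) (compose (asrc a) (amap b) (amap a)) (atgt b))\<rparr>"

definition pSet_ob :: "'u universe \<Rightarrow> 'u pset set" where
  "pSet_ob V = {(X, R). X \<in> usets V \<and> equiv X R}"

definition pSet_cat :: "'u universe \<Rightarrow> ('u pset, ('u pset, 'u \<Rightarrow> 'u) arrow) cat_data" where
  "pSet_cat V = \<lparr>
     Ob = pSet_ob V,
     Ar = {Arrow A f B | A f B. A \<in> pSet_ob V \<and> B \<in> pSet_ob V \<and> f \<in> fst A \<rightarrow>\<^sub>E fst B \<and>
             (\<forall>(x, x') \<in> snd A. (f x, f x') \<in> snd B)},
     Dom = asrc, Cod = atgt,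
     Id = (\<lambda>A. Arrow A (\<lambda>x\<in>fst A. x) A),
     Cmp = (\<lambda>a b. Arrow (asrc a) (compose (fst (asrc a)) (amap b) (amap a)) (atgt b))\<rparr>"

definition subMat :: "'u universe \<Rightarrow> ('u set, ('u set, 'u \<Rightarrow> 'u \<Rightarrow> real) arrow) cat_data" where
  "subMat V = \<lparr>
     Ob = usets V,
     Ar = {Arrow X M Y | X M Y. X \<in> usets V \<and> Y \<in> usets V \<and> M \<in> submat X Y},
     Dom = asrc, Cod = atgt,
     Id = (\<lambda>X. Arrow X (mat_id X) X),
     Cmp = (\<lambda>a b. Arrow (asrc a) (mat_mult (amap a) (amap b)) (atgt b))\<rparr>"

definition psubMat :: "'u universe \<Rightarrow> ('u pset, ('u pset, 'u \<Rightarrow> 'u \<Rightarrow> real) arrow) cat_data" where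
  "psubMat V = \<lparr>
     Ob = pSet_ob V,
     Ar = {Arrow A M B | A M B. A \<in> pSet_ob V \<and> B \<in> pSet_ob V \<and>
             M \<in> submat (fst A) (fst B) \<and> partitioned A B M},
     Dom = asrc, Cod = atgt,
     Id = (\<lambda>A. Arrow A (mat_id (fst A)) A),
     Cmp = (\<lambda>a b. Arrow (asrc a) (mat_mult (amap a) (amap b)) (atgt b))\<rparr>"


section \<open>Cartesian products and the subdistribution monads\<close>

text \<open>The underlying functions, shared by the structures on sets and on partitioned sets.\<close>

definition prod_fun :: "'u universe \<Rightarrow> 'u set \<Rightarrow> 'u set \<Rightarrow> ('u \<Rightarrow> 'u) \<Rightarrow> ('u \<Rightarrow> 'u) \<Rightarrow> 'u \<Rightarrow> 'u" where
  "prod_fun V X X' f f' = (\<lambda>w\<in>uprod V X X'. upair V (f (ufst V w), f' (usnd V w)))"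

definition assoc_fun :: "'u universe \<Rightarrow> 'u set \<Rightarrow> 'u set \<Rightarrow> 'u set \<Rightarrow> 'u \<Rightarrow> 'u" where
  "assoc_fun V X Y Z = (\<lambda>w\<in>uprod V (uprod V X Y) Z.
     upair V (ufst V (ufst V w), upair V (usnd V (ufst V w), usnd V w)))"

definition left_fun :: "'u universe \<Rightarrow> 'u set \<Rightarrow> 'u \<Rightarrow> 'u" where
  "left_fun V X = (\<lambda>w\<in>uprod V {upoint V} X. usnd V w)"

definition right_fun :: "'u universe \<Rightarrow> 'u set \<Rightarrow> 'u \<Rightarrow> 'u" where
  "right_fun V X = (\<lambda>w\<in>uprod V X {upoint V}. ufst V w)"

definition push_fun :: "'u universe \<Rightarrow> 'u set \<Rightarrow> ('u \<Rightarrow> 'u) \<Rightarrow> 'u \<Rightarrow> 'u" where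
  "push_fun V X f = (\<lambda>e\<in>usubdist V X.
     let p = the_dist V e in udist V (\<lambda>y. \<Sum>x\<in>{x \<in> supp p. f x = y}. p x))"

definition unit_fun :: "'u universe \<Rightarrow> 'u set \<Rightarrow> 'u \<Rightarrow> 'u" where
  "unit_fun V X = (\<lambda>x\<in>X. udist V (dirac x))"

definition mult_fun :: "'u universe \<Rightarrow> 'u set \<Rightarrow> 'u \<Rightarrow> 'u" where
  "mult_fun V X = (\<lambda>e\<in>usubdist V (usubdist V X).
     let \<sigma> = the_dist V e in udist V (\<lambda>x. \<Sum>d\<in>supp \<sigma>. \<sigma> d * the_dist V d x))"

definition str_fun :: "'u universe \<Rightarrow> 'u set \<Rightarrow> 'u set \<Rightarrow> 'u \<Rightarrow> 'u" where
  "str_fun V X Y = (\<lambda>w\<in>uprod V (usubdist V X) (usubdist V Y).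
     let \<sigma> = the_dist V (ufst V w); \<tau> = the_dist V (usnd V w)
     in udist V (\<lambda>z. if z \<in> range (upair V) then \<sigma> (ufst V z) * \<tau> (usnd V z) else 0))"

definition Set_prod :: "'u universe \<Rightarrow> ('u set, ('u set, 'u \<Rightarrow> 'u) arrow) tensor_data" where
  "Set_prod V = \<lparr>
     tob = uprod V,
     tar = (\<lambda>a b. Arrow (uprod V (asrc a) (asrc b))
                    (prod_fun V (asrc a) (asrc b) (amap a) (amap b))
                    (uprod V (atgt a) (atgt b))),
     tunit = {upoint V},
     tassoc = (\<lambda>X Y Z. Arrow (uprod V (uprod V X Y) Z) (assoc_fun V X Y Z) (uprod V X (uprod V Y Z))),
     tleft = (\<lambda>X. Arrow (uprod V {upoint V} X) (left_fun V X) X),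
     tright = (\<lambda>X. Arrow (uprod V X {upoint V}) (right_fun V X) X)\<rparr>"

definition pone :: "'u universe \<Rightarrow> 'u pset" where
  "pone V = ({upoint V}, {(upoint V, upoint V)})"

definition pSet_prod :: "'u universe \<Rightarrow> ('u pset, ('u pset, 'u \<Rightarrow> 'u) arrow) tensor_data" where
  "pSet_prod V = \<lparr>
     tob = pprod V,
     tar = (\<lambda>a b. Arrow (pprod V (asrc a) (asrc b))
                    (prod_fun V (fst (asrc a)) (fst (asrc b)) (amap a) (amap b))
                    (pprod V (atgt a) (atgt b))),
     tunit = pone V,
     tassoc = (\<lambda>A B C. Arrow (pprod V (pprod V A B) C) (assoc_fun V (fst A) (fst B) (fst C))
                         (pprod V A (pprod V B C))),
     tleft = (\<lambda>A. Arrow (pprod V (pone V) A) (left_fun V (fst A)) A),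
     tright = (\<lambda>A. Arrow (pprod V A (pone V)) (right_fun V (fst A)) A)\<rparr>"

definition Set_D :: "'u universe \<Rightarrow> ('u set, ('u set, 'u \<Rightarrow> 'u) arrow) monad_data" where
  "Set_D V = \<lparr>
     fob = usubdist V,
     far = (\<lambda>a. Arrow (usubdist V (asrc a)) (push_fun V (asrc a) (amap a)) (usubdist V (atgt a))),
     munit = (\<lambda>X. Arrow X (unit_fun V X) (usubdist V X)),
     mmult = (\<lambda>X. Arrow (usubdist V (usubdist V X)) (mult_fun V X) (usubdist V X)),
     mstr = (\<lambda>X Y. Arrow (uprod V (usubdist V X) (usubdist V Y)) (str_fun V X Y)
                     (usubdist V (uprod V X Y)))\<rparr>"

definition pSet_D :: "'u universe \<Rightarrow> ('u pset, ('u pset, 'u \<Rightarrow> 'u) arrow) monad_data" where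
  "pSet_D V = \<lparr>
     fob = psubdist V,
     far = (\<lambda>a. Arrow (psubdist V (asrc a)) (push_fun V (fst (asrc a)) (amap a)) (psubdist V (atgt a))),
     munit = (\<lambda>A. Arrow A (unit_fun V (fst A)) (psubdist V A)),
     mmult = (\<lambda>A. Arrow (psubdist V (psubdist V A)) (mult_fun V (fst A)) (psubdist V A)),
     mstr = (\<lambda>A B. Arrow (pprod V (psubdist V A) (psubdist V B)) (str_fun V (fst A) (fst B))
                     (psubdist V (pprod V A B)))\<rparr>"

abbreviation Kl_D where
  "Kl_D V \<equiv> Kleisli (Set_cat V) (Set_D V)"

abbreviation Kl_D_tensor where
  "Kl_D_tensor V \<equiv> Kleisli_tensor (Set_cat V) (Set_prod V) (Set_D V)"

abbreviation Kl_pD where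
  "Kl_pD V \<equiv> Kleisli (pSet_cat V) (pSet_D V)"

abbreviation Kl_pD_tensor where
  "Kl_pD_tensor V \<equiv> Kleisli_tensor (pSet_cat V) (pSet_prod V) (pSet_D V)"

end

theory Submission
  imports Defs
begin

text \<open>
  A Kleisli morphism from \<open>X\<close> to \<open>Y\<close> is a family of subdistributions on \<open>Y\<close> indexed by \<open>X\<close>, that is,
  the family of rows of a matrix. Reading off rows is bijective on morphisms and the identity on
  objects, and it turns Kleisli composition into matrix multiplication and the Kleisli tensor product
  into the Kronecker product. So it suffices to show that matrices form a monoidal category: the
  Kleisli categories are isomorphic to it and inherit all laws, without any appeal to the monad laws.
  In the partitioned case the point is that a matrix is partitioned iff equivalent indices have
  equivalent rows: the mass that \<open>pM\<close> gives to a class is a sum over the classes of \<open>X\<close>, on each of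
  which the mass of the rows of \<open>M\<close> is constant.

  Both cases are instances of one construction, in which an object \<open>A\<close> has an underlying set \<open>U A\<close> and
  the matrices are restricted by a predicate \<open>adm\<close>.
\<close>

section \<open>Vectors and matrices\<close>

text \<open>The image of a function under the canonical functor to the Kleisli category, read as a
  matrix. All associators and unitors below have this form.\<close>

definition fun_mat :: "'u set \<Rightarrow> ('u \<Rightarrow> 'u) \<Rightarrow> 'u \<Rightarrow> 'u \<Rightarrow> real" where
  "fun_mat X f = (\<lambda>x y. if x \<in> X \<and> y = f x then 1 else 0)"

text \<open>Nonnegative entries are each bounded by their total, so the bound by 1 on single entries
  follows from the bound on the sum.\<close>

lemma subdistI:
  assumes "finite (supp p)" "supp p \<subseteq> X" "\<And>x. 0 \<le> p x" "sum p (supp p) \<le> 1"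
  shows "p \<in> subdist X"
proof -
  have "p x \<le> 1" for x
  proof (cases "x \<in> supp p")
    case True
    then have "p x \<le> sum p (supp p)"
      using assms by (intro member_le_sum) auto
    then show ?thesis using assms(4) by simp
  qed (simp add: supp_def)
  then show ?thesis using assms by (simp add: subdist_def)
qed

lemma subdist_finite: "p \<in> subdist X \<Longrightarrow> finite (supp p)"
  and subdist_supp: "p \<in> subdist X \<Longrightarrow> supp p \<subseteq> X"
  and subdist_nonneg: "p \<in> subdist X \<Longrightarrow> 0 \<le> p x"
  and subdist_sum: "p \<in> subdist X \<Longrightarrow> sum p (supp p) \<le> 1"
  and subdist_UNIV: "p \<in> subdist X \<Longrightarrow> p \<in> subdist UNIV"
  by (simp_all add: subdist_def)

lemma subdist_outside: "p \<in> subdist X \<Longrightarrow> x \<notin> X \<Longrightarrow> p x = 0"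
  using subdist_supp[of p X] by (auto simp: supp_def)

lemma zero_subdist: "(\<lambda>_. 0) \<in> subdist X"
  by (simp add: subdist_def supp_def)

lemma supp_dirac: "supp (dirac x) = {x}"
  by (auto simp: supp_def dirac_def)

lemma dirac_subdist: "x \<in> X \<Longrightarrow> dirac x \<in> subdist X"
  by (rule subdistI) (simp_all add: supp_dirac, simp_all add: dirac_def)

lemma submat_row: "M \<in> submat X Y \<Longrightarrow> M x \<in> subdist Y"
  by (cases "x \<in> X") (simp_all add: submat_def zero_subdist)

lemma submat_outside: "M \<in> submat X Y \<Longrightarrow> x \<notin> X \<or> y \<notin> Y \<Longrightarrow> M x y = 0"
  using subdist_outside[OF submat_row[of M X Y x], of y] by (auto simp: submat_def)

lemma submat_eqI:
  assumes "M \<in> submat X Y" "N \<in> submat X Y" "\<And>x y. x \<in> X \<Longrightarrow> y \<in> Y \<Longrightarrow> M x y = N x y"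
  shows "M = N"
proof (intro ext)
  fix x y
  show "M x y = N x y"
    using assms(3)[of x y] submat_outside[OF assms(1), of x y] submat_outside[OF assms(2), of x y]
    by metis
qed

lemma fun_mat_submat: "f \<in> X \<rightarrow> Y \<Longrightarrow> fun_mat X f \<in> submat X Y"
  unfolding submat_def
proof (intro CollectI conjI ballI allI impI)
  fix x assume "f \<in> X \<rightarrow> Y" "x \<in> X"
  then show "fun_mat X f x \<in> subdist Y"
    using dirac_subdist[of "f x" Y] by (auto simp: fun_mat_def dirac_def)
qed (simp add: fun_mat_def)

lemma fun_mat_row: "x \<in> X \<Longrightarrow> fun_mat X f x = dirac (f x)"
  by (simp add: fun_mat_def dirac_def)

lemma fun_mat_cong: "(\<And>x. x \<in> X \<Longrightarrow> f x = g x) \<Longrightarrow> fun_mat X f = fun_mat X g"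
  by (auto simp: fun_mat_def fun_eq_iff)

lemma mat_id_fun_mat: "mat_id X = fun_mat X (\<lambda>x. x)"
  by (auto simp: fun_mat_def mat_id_def fun_eq_iff)

section \<open>Products of vectors with matrices\<close>

lemma mat_mult_row: "mat_mult M N x = vec_mat (M x) N"
  by (simp add: mat_mult_def vec_mat_def)

text \<open>Brings sums over different supports to one finite index set, as is required before sums
  are exchanged.\<close>

lemma vec_mat_superset:
  "finite S \<Longrightarrow> supp p \<subseteq> S \<Longrightarrow> vec_mat p M y = (\<Sum>x\<in>S. p x * M x y)"
  unfolding vec_mat_def by (rule sum.mono_neutral_left) (auto simp: supp_def)

lemma vec_mat_dirac: "vec_mat (dirac x) M = M x"
  by (simp add: vec_mat_def supp_dirac) (simp add: dirac_def)

lemma vec_mat_zero: "vec_mat (\<lambda>_. 0) M = (\<lambda>_. 0)"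
  by (simp add: vec_mat_def)

lemma supp_vec_mat: "supp (vec_mat p M) \<subseteq> (\<Union>x\<in>supp p. supp (M x))"
proof
  fix y assume "y \<in> supp (vec_mat p M)"
  then have "(\<Sum>x\<in>supp p. p x * M x y) \<noteq> 0" by (simp add: supp_def vec_mat_def)
  then obtain x where "x \<in> supp p" "p x * M x y \<noteq> 0" by (meson sum.neutral)
  then show "y \<in> (\<Union>x\<in>supp p. supp (M x))" by (auto simp: supp_def)
qed

text \<open>Exchange of two finite sums over the union of the supports of the relevant rows. The
  matrix \<open>N\<close> is arbitrary, which later admits indicator vectors and the decoding
  \<open>the_dist V\<close> in its place.\<close>

lemma vec_mat_assoc:
  assumes fp: "finite (supp p)" and fM: "\<And>x. x \<in> supp p \<Longrightarrow> finite (supp (M x))"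
  shows "vec_mat (vec_mat p M) N = vec_mat p (mat_mult M N)"
proof
  fix z
  let ?S = "\<Union>x\<in>supp p. supp (M x)"
  have fS: "finite ?S" using assms by blast
  have "vec_mat (vec_mat p M) N z = (\<Sum>y\<in>?S. vec_mat p M y * N y z)"
    by (rule vec_mat_superset[OF fS supp_vec_mat])
  also have "\<dots> = (\<Sum>y\<in>?S. \<Sum>x\<in>supp p. p x * M x y * N y z)"
    by (simp add: vec_mat_def sum_distrib_right)
  also have "\<dots> = (\<Sum>x\<in>supp p. \<Sum>y\<in>?S. p x * M x y * N y z)"
    by (rule sum.swap)
  also have "\<dots> = (\<Sum>x\<in>supp p. p x * vec_mat (M x) N z)"
  proof (rule sum.cong[OF refl])
    fix x assume "x \<in> supp p"
    then have "vec_mat (M x) N z = (\<Sum>y\<in>?S. M x y * N y z)"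
      by (intro vec_mat_superset[OF fS]) blast
    then show "(\<Sum>y\<in>?S. p x * M x y * N y z) = p x * vec_mat (M x) N z"
      by (simp add: sum_distrib_left mult.assoc)
  qed
  also have "\<dots> = vec_mat p (mat_mult M N) z"
    by (simp add: vec_mat_def mat_mult_def)
  finally show "vec_mat (vec_mat p M) N z = vec_mat p (mat_mult M N) z" .
qed

lemma vec_mat_subdist:
  assumes p: "p \<in> subdist X" and M: "M \<in> submat X Y"
  shows "vec_mat p M \<in> subdist Y"
proof (rule subdistI)
  let ?S = "\<Union>x\<in>supp p. supp (M x)"
  have fS: "finite ?S"
    using subdist_finite[OF p] subdist_finite[OF submat_row[OF M]] by blast
  show "finite (supp (vec_mat p M))"
    by (rule finite_subset[OF supp_vec_mat fS])
  show "supp (vec_mat p M) \<subseteq> Y"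
    using supp_vec_mat[of p M] subdist_supp[OF submat_row[OF M]] by blast
  show "0 \<le> vec_mat p M y" for y
    unfolding vec_mat_def
    using subdist_nonneg[OF p] subdist_nonneg[OF submat_row[OF M]] by (simp add: sum_nonneg)
  \<comment> \<open>Exchanging the sums writes the total mass as the sum of the row masses weighted
    by \<open>p\<close>; each row mass is at most 1.\<close>
  have "sum (vec_mat p M) (supp (vec_mat p M)) = (\<Sum>y\<in>?S. vec_mat p M y)"
    by (rule sum.mono_neutral_left[OF fS supp_vec_mat]) (simp add: supp_def)
  also have "\<dots> = (\<Sum>x\<in>supp p. \<Sum>y\<in>?S. p x * M x y)"
    unfolding vec_mat_def by (rule sum.swap)
  also have "\<dots> = (\<Sum>x\<in>supp p. p x * sum (M x) (supp (M x)))"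
  proof (rule sum.cong[OF refl])
    fix x assume "x \<in> supp p"
    then have "sum (M x) (supp (M x)) = sum (M x) ?S"
      by (intro sum.mono_neutral_left[OF fS]) (auto simp: supp_def)
    then show "(\<Sum>y\<in>?S. p x * M x y) = p x * sum (M x) (supp (M x))"
      by (simp add: sum_distrib_left)
  qed
  also have "\<dots> \<le> (\<Sum>x\<in>supp p. p x)"
    using subdist_nonneg[OF p] subdist_sum[OF submat_row[OF M]]
    by (intro sum_mono mult_left_le) auto
  also have "\<dots> \<le> 1" by (rule subdist_sum[OF p])
  finally show "sum (vec_mat p M) (supp (vec_mat p M)) \<le> 1" .
qed

lemma mat_mult_submat: "M \<in> submat X Y \<Longrightarrow> N \<in> submat Y Z \<Longrightarrow> mat_mult M N \<in> submat X Z"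
  unfolding submat_def[of X Z]
proof (intro CollectI conjI ballI allI impI)
  assume M: "M \<in> submat X Y" and N: "N \<in> submat Y Z"
  show "mat_mult M N x \<in> subdist Z" for x
    unfolding mat_mult_row by (rule vec_mat_subdist[OF submat_row[OF M] N])
  show "mat_mult M N x = (\<lambda>_. 0)" if "x \<notin> X" for x
    using M that by (simp add: mat_mult_row submat_def vec_mat_zero)
qed

lemma mat_mult_assoc:
  assumes "M \<in> submat W X" "N \<in> submat X Y"
  shows "mat_mult (mat_mult M N) L = mat_mult M (mat_mult N L)"
proof
  fix x
  have "vec_mat (vec_mat (M x) N) L = vec_mat (M x) (mat_mult N L)"
    using subdist_finite[OF submat_row[OF assms(1)]] subdist_finite[OF submat_row[OF assms(2)]]
    by (intro vec_mat_assoc)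
  then show "mat_mult (mat_mult M N) L x = mat_mult M (mat_mult N L) x"
    by (simp add: mat_mult_row)
qed

section \<open>Matrices of functions\<close>

lemma fun_mat_mult: "mat_mult (fun_mat X f) N = (\<lambda>x. if x \<in> X then N (f x) else (\<lambda>_. 0))"
proof
  fix x
  show "mat_mult (fun_mat X f) N x = (if x \<in> X then N (f x) else (\<lambda>_. 0))"
  proof (cases "x \<in> X")
    case True
    then show ?thesis by (simp add: mat_mult_row fun_mat_row vec_mat_dirac)
  next
    case False
    then have "fun_mat X f x = (\<lambda>_. 0)" by (simp add: fun_mat_def)
    with False show ?thesis by (simp add: mat_mult_row vec_mat_zero)
  qed
qed

lemma fun_mat_comp:
  "f \<in> X \<rightarrow> Y \<Longrightarrow> mat_mult (fun_mat X f) (fun_mat Y g) = fun_mat X (\<lambda>x. g (f x))"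
  unfolding fun_mat_mult by (auto simp: fun_mat_def fun_eq_iff)

text \<open>The right-hand side is the formula in \<open>push_fun\<close>: the monad acts on a
  function as multiplication by its matrix.\<close>

lemma vec_mat_fun_mat:
  assumes "p \<in> subdist Y"
  shows "vec_mat p (fun_mat Y g) z = (\<Sum>y\<in>{y \<in> supp p. g y = z}. p y)"
proof -
  have "vec_mat p (fun_mat Y g) z = (\<Sum>y\<in>supp p. if g y = z then p y else 0)"
    unfolding vec_mat_def
    by (rule sum.cong) (use subdist_supp[OF assms] in \<open>auto simp: fun_mat_def\<close>)
  also have "\<dots> = (\<Sum>y\<in>{y \<in> supp p. g y = z}. p y)"
    using subdist_finite[OF assms] by (simp add: sum.inter_filter)
  finally show ?thesis .
qed

lemma vec_mat_id: "p \<in> subdist X \<Longrightarrow> vec_mat p (mat_id X) = p"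
proof
  fix y assume p: "p \<in> subdist X"
  have "{x \<in> supp p. x = y} = (if y \<in> supp p then {y} else {})" by auto
  then show "vec_mat p (mat_id X) y = p y"
    by (simp add: mat_id_fun_mat vec_mat_fun_mat[OF p]) (simp add: supp_def)
qed

lemma mat_mult_id_right: "M \<in> submat X Y \<Longrightarrow> mat_mult M (mat_id Y) = M"
  by (rule ext) (simp add: mat_mult_row vec_mat_id[OF submat_row])

lemma mat_mult_id_left: "M \<in> submat X Y \<Longrightarrow> mat_mult (mat_id X) M = M"
  by (rule ext) (simp add: mat_id_fun_mat fun_mat_mult submat_def)

lemma mat_id_submat: "mat_id X \<in> submat X X"
  unfolding mat_id_fun_mat by (rule fun_mat_submat) simp

text \<open>By injectivity the fibre over \<open>g y\<close> meets the support in at most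
  \<open>y\<close>, so columns are relabelled and never added up.\<close>

lemma mat_mult_fun_mat_inj:
  assumes M: "M \<in> submat X Y" and g: "inj_on g Y" and y: "y \<in> Y"
  shows "mat_mult M (fun_mat Y g) x (g y) = M x y"
proof -
  have "{y' \<in> supp (M x). g y' = g y} = (if y \<in> supp (M x) then {y} else {})"
    using subdist_supp[OF submat_row[OF M, of x]] inj_onD[OF g _ _ y] by auto
  then show ?thesis
    by (simp add: mat_mult_row vec_mat_fun_mat[OF submat_row[OF M]]) (simp add: supp_def)
qed

text \<open>Reduces naturality of a constraint to an equation between entries. In use,
  \<open>f\<close> and \<open>g\<close> are the same structure map at the sources and at the
  targets. Surjectivity of \<open>g\<close> presents every column as some \<open>g y\<close>, and
  injectivity reads off its entry.\<close>

lemma fun_mat_natural: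
  assumes M: "M \<in> submat X Y" and M': "M' \<in> submat X' Y'"
    and f: "f \<in> X \<rightarrow> X'" and g: "bij_betw g Y Y'"
    and eq: "\<And>x y. x \<in> X \<Longrightarrow> y \<in> Y \<Longrightarrow> M x y = M' (f x) (g y)"
  shows "mat_mult M (fun_mat Y g) = mat_mult (fun_mat X f) M'"
proof (rule submat_eqI[of _ X Y'])
  have "g \<in> Y \<rightarrow> Y'" using g by (auto simp: bij_betw_def)
  then show "mat_mult M (fun_mat Y g) \<in> submat X Y'"
    by (intro mat_mult_submat[OF M] fun_mat_submat)
  show "mat_mult (fun_mat X f) M' \<in> submat X Y'"
    by (rule mat_mult_submat[OF fun_mat_submat[OF f] M'])
  fix x z assume x: "x \<in> X" and "z \<in> Y'"
  then obtain y where "y \<in> Y" "z = g y" using g by (auto simp: bij_betw_def)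
  then show "mat_mult M (fun_mat Y g) x z = mat_mult (fun_mat X f) M' x z"
    using x g eq by (simp add: mat_mult_fun_mat_inj[OF M] fun_mat_mult bij_betw_def)
qed

section \<open>Kronecker products\<close>

context set_universe
begin

lemma ufst_upair [simp]: "ufst V (upair V (x, y)) = x"
  and usnd_upair [simp]: "usnd V (upair V (x, y)) = y"
  by (simp_all add: ufst_def usnd_def inv_f_f[OF upair_inj])

lemma upair_eq_iff [simp]: "upair V (x, y) = upair V (x', y') \<longleftrightarrow> x = x' \<and> y = y'"
  using inj_eq[OF upair_inj] by auto

lemma upair_in_uprod [simp]: "upair V (x, y) \<in> uprod V X Y \<longleftrightarrow> x \<in> X \<and> y \<in> Y"
  by (auto simp: uprod_def)

lemma uprodE:
  assumes "w \<in> uprod V X Y"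
  obtains x y where "w = upair V (x, y)" "x \<in> X" "y \<in> Y"
  using assms by (auto simp: uprod_def)

text \<open>The structure map \<open>t\<close> of the monad before encoding by
  \<open>udist V\<close>; also the shape of a row of a Kronecker product.\<close>

definition vec_kron :: "('u \<Rightarrow> real) \<Rightarrow> ('u \<Rightarrow> real) \<Rightarrow> 'u \<Rightarrow> real" where
  "vec_kron p q = (\<lambda>z. if z \<in> range (upair V) then p (ufst V z) * q (usnd V z) else 0)"

lemma vec_kron_upair [simp]: "vec_kron p q (upair V (x, y)) = p x * q y"
  by (simp add: vec_kron_def)

lemma supp_vec_kron: "supp (vec_kron p q) = upair V ` (supp p \<times> supp q)"
  by (auto simp: supp_def vec_kron_def)

lemma sum_upair:
  "(\<Sum>z\<in>upair V ` (A \<times> B). f z) = (\<Sum>x\<in>A. \<Sum>y\<in>B. f (upair V (x, y)))"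
  by (simp add: sum.reindex[OF inj_on_subset[OF upair_inj]] sum.cartesian_product)

lemma vec_kron_subdist:
  assumes p: "p \<in> subdist X" and q: "q \<in> subdist Y"
  shows "vec_kron p q \<in> subdist (uprod V X Y)"
proof (rule subdistI)
  show "finite (supp (vec_kron p q))"
    using subdist_finite[OF p] subdist_finite[OF q] by (simp add: supp_vec_kron)
  show "supp (vec_kron p q) \<subseteq> uprod V X Y"
    using subdist_supp[OF p] subdist_supp[OF q] by (auto simp: supp_vec_kron)
  show "0 \<le> vec_kron p q x" for x
    using subdist_nonneg[OF p] subdist_nonneg[OF q] by (simp add: vec_kron_def)
  have "sum (vec_kron p q) (supp (vec_kron p q)) = sum p (supp p) * sum q (supp q)"
    by (simp add: supp_vec_kron sum_upair sum_product)
  also have "\<dots> \<le> 1"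
    using subdist_sum[OF p] subdist_sum[OF q] subdist_nonneg[OF p] subdist_nonneg[OF q]
    by (intro mult_le_one sum_nonneg) auto
  finally show "sum (vec_kron p q) (supp (vec_kron p q)) \<le> 1" .
qed

lemma kron_row [simp]: "kron V M N (upair V (x, u)) = vec_kron (M x) (N u)"
  by (simp add: kron_def vec_kron_def cong: if_cong)

lemma kron_submat:
  assumes M: "M \<in> submat X Y" and N: "N \<in> submat X' Y'"
  shows "kron V M N \<in> submat (uprod V X X') (uprod V Y Y')"
  unfolding submat_def[of "uprod V X X'"]
proof (intro CollectI conjI ballI allI impI)
  fix w assume "w \<in> uprod V X X'"
  then obtain x u where "w = upair V (x, u)" by (rule uprodE)
  then show "kron V M N w \<in> subdist (uprod V Y Y')"
    by (simp add: vec_kron_subdist submat_row[OF M] submat_row[OF N])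
next
  fix w assume w: "w \<notin> uprod V X X'"
  show "kron V M N w = (\<lambda>_. 0)"
  proof (cases "w \<in> range (upair V)")
    case True
    then obtain x u where wxu: "w = upair V (x, u)" by auto
    with w have "M x = (\<lambda>_. 0) \<or> N u = (\<lambda>_. 0)"
      using M N by (auto simp: submat_def)
    with wxu show ?thesis by (auto simp: vec_kron_def)
  qed (simp add: kron_def)
qed

text \<open>With \<open>fun_mat_comp\<close>, this turns the coherence equations between constraints
  into equations between functions.\<close>

lemma kron_fun_mat:
  "kron V (fun_mat X f) (fun_mat Y g) = fun_mat (uprod V X Y) (\<lambda>w. upair V (f (ufst V w), g (usnd V w)))"
proof (intro ext)
  fix w z
  show "kron V (fun_mat X f) (fun_mat Y g) w z
    = fun_mat (uprod V X Y) (\<lambda>w. upair V (f (ufst V w), g (usnd V w))) w z"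
  proof (cases "w \<in> range (upair V) \<and> z \<in> range (upair V)")
    case True
    then obtain x y a b where "w = upair V (x, y)" "z = upair V (a, b)" by auto
    then show ?thesis by (auto simp: fun_mat_def)
  next
    case False
    then show ?thesis by (auto simp: kron_def fun_mat_def uprod_def)
  qed
qed

lemma kron_id: "kron V (mat_id X) (mat_id Y) = mat_id (uprod V X Y)"
  unfolding mat_id_fun_mat kron_fun_mat by (rule fun_mat_cong) (auto elim!: uprodE)

text \<open>A sum over pairs of products of terms factors into a product of two sums. This is the
  interchange law \<open>kron_mult\<close> for a single row.\<close>

lemma vec_kron_mat:
  "vec_mat (vec_kron p q) (kron V M N) = vec_kron (vec_mat p M) (vec_mat q N)"
proof
  fix z
  show "vec_mat (vec_kron p q) (kron V M N) z = vec_kron (vec_mat p M) (vec_mat q N) z"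
  proof (cases "z \<in> range (upair V)")
    case True
    then obtain a b where "z = upair V (a, b)" by auto
    then show ?thesis
      by (simp add: vec_mat_def supp_vec_kron sum_upair sum_product mult_ac)
  next
    case False
    then show ?thesis by (simp add: vec_mat_def kron_def vec_kron_def)
  qed
qed

lemma kron_mult:
  assumes "M \<in> submat X Y" "N \<in> submat Y Z" "M' \<in> submat X' Y'" "N' \<in> submat Y' Z'"
  shows "kron V (mat_mult M N) (mat_mult M' N') = mat_mult (kron V M M') (kron V N N')"
proof (rule submat_eqI)
  show "kron V (mat_mult M N) (mat_mult M' N') \<in> submat (uprod V X X') (uprod V Z Z')"
    by (intro kron_submat mat_mult_submat[OF assms(1,2)] mat_mult_submat[OF assms(3,4)])
  show "mat_mult (kron V M M') (kron V N N') \<in> submat (uprod V X X') (uprod V Z Z')"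
    by (intro mat_mult_submat[OF kron_submat[OF assms(1,3)]] kron_submat assms)
  fix w z assume "w \<in> uprod V X X'"
  then obtain x u where "w = upair V (x, u)" by (rule uprodE)
  then show "kron V (mat_mult M N) (mat_mult M' N') w z = mat_mult (kron V M M') (kron V N N') w z"
    by (simp add: mat_mult_row vec_kron_mat)
qed

end

section \<open>Transport of monoidal structures along isomorphisms of categories\<close>

text \<open>An isomorphism of categories that is the identity on objects. Only \<open>D\<close> is
  assumed to satisfy any laws; the structure of \<open>K\<close> is described on morphisms
  \<open>G f\<close>, as the image under \<open>G\<close> of the structure of
  \<open>D\<close>.\<close>

locale transported_monoidal = monoidal_category D T
  for D :: "('o, 'm) cat_data" and T :: "('o, 'm) tensor_data" +
  fixes K :: "('o, 'k) cat_data" and S :: "('o, 'k) tensor_data"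
    and F :: "'k \<Rightarrow> 'm" and G :: "'m \<Rightarrow> 'k"
  assumes Ob_K: "Ob K = Ob D"
    and F_hom: "k \<in> hom K x y \<Longrightarrow> F k \<in> hom D x y"
    and G_hom: "f \<in> hom D x y \<Longrightarrow> G f \<in> hom K x y"
    and F_G: "f \<in> hom D x y \<Longrightarrow> F (G f) = f"
    and G_F: "k \<in> hom K x y \<Longrightarrow> G (F k) = k"
    and Id_K: "x \<in> Ob D \<Longrightarrow> Id K x = G (Id D x)"
    and Cmp_K: "f \<in> hom D x y \<Longrightarrow> g \<in> hom D y z \<Longrightarrow> Cmp K (G f) (G g) = G (Cmp D f g)"
    and tob_K: "tob S = tob T"
    and tunit_K: "tunit S = tunit T"
    and tar_K: "f \<in> hom D x y \<Longrightarrow> f' \<in> hom D x' y' \<Longrightarrow> tar S (G f) (G f') = G (tar T f f')"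
    and tassoc_K: "x \<in> Ob D \<Longrightarrow> y \<in> Ob D \<Longrightarrow> z \<in> Ob D \<Longrightarrow> tassoc S x y z = G (tassoc T x y z)"
    and tleft_K: "x \<in> Ob D \<Longrightarrow> tleft S x = G (tleft T x)"
    and tright_K: "x \<in> Ob D \<Longrightarrow> tright S x = G (tright T x)"
begin

text \<open>Every morphism of \<open>K\<close> has the form \<open>G f\<close>, so a law in
  \<open>K\<close> becomes \<open>G\<close> applied to the same law in \<open>D\<close>.\<close>

lemma hom_KE:
  assumes "k \<in> hom K x y"
  obtains f where "k = G f" "f \<in> hom D x y"
  using G_F[OF assms] F_hom[OF assms] by metis

lemma hom_Ob: "f \<in> hom D x y \<Longrightarrow> x \<in> Ob D" "f \<in> hom D x y \<Longrightarrow> y \<in> Ob D"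
  using Dom_Ob Cod_Ob by (auto simp: hom_def)

lemma iso_hom: "iso_in D x y f \<Longrightarrow> f \<in> hom D x y"
  by (simp add: iso_in_def)

lemma iso_Id: "x \<in> Ob D \<Longrightarrow> iso_in D x x (Id D x)"
  unfolding iso_in_def using Id_hom Id_left by blast

lemma iso_K: "iso_in D x y f \<Longrightarrow> iso_in K x y (G f)"
  unfolding iso_in_def
proof (elim conjE bexE)
  fix g assume fg: "f \<in> hom D x y" "g \<in> hom D y x" "Cmp D f g = Id D x" "Cmp D g f = Id D y"
  then have "Cmp K (G f) (G g) = Id K x" "Cmp K (G g) (G f) = Id K y"
    using hom_Ob[OF fg(1)] by (simp_all add: Cmp_K[OF fg(1,2)] Cmp_K[OF fg(2,1)] Id_K)
  then show "G f \<in> hom K x y \<and> (\<exists>g\<in>hom K y x. Cmp K (G f) g = Id K x \<and> Cmp K g (G f) = Id K y)"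
    using G_hom fg by blast
qed

section \<open>Laws of the transported structure\<close>

lemma category_K: "category K"
proof
  show "Dom K k \<in> Ob K" if "k \<in> Ar K" for k
    using hom_Ob(1)[OF F_hom[of k "Dom K k" "Cod K k"]] that by (simp add: hom_def Ob_K)
  show "Cod K k \<in> Ob K" if "k \<in> Ar K" for k
    using hom_Ob(2)[OF F_hom[of k "Dom K k" "Cod K k"]] that by (simp add: hom_def Ob_K)
  show "Id K x \<in> hom K x x" if "x \<in> Ob K" for x
    using that Id_hom G_hom by (simp add: Ob_K Id_K)
  show "Cmp K f g \<in> hom K x z" if "f \<in> hom K x y" "g \<in> hom K y z" for f g x y z
    using that by (elim hom_KE) (simp add: Cmp_K Cmp_hom G_hom)
  show "Cmp K (Id K x) f = f" if "f \<in> hom K x y" for f x y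
    using that by (elim hom_KE) (simp add: Id_K hom_Ob Cmp_K[OF Id_hom] Id_left)
  show "Cmp K f (Id K y) = f" if "f \<in> hom K x y" for f x y
    using that by (elim hom_KE) (simp add: Id_K hom_Ob Cmp_K[OF _ Id_hom] Id_right)
  show "Cmp K (Cmp K f g) h = Cmp K f (Cmp K g h)"
    if "f \<in> hom K w x" "g \<in> hom K x y" "h \<in> hom K y z" for f g h w x y z
    using that
    by (elim hom_KE) (simp add: Cmp_K Cmp_K[OF Cmp_hom] Cmp_K[OF _ Cmp_hom] Cmp_assoc)
qed

lemma monoidal_K: "monoidal_category K S"
proof -
  interpret K: category K by (rule category_K)
  show ?thesis
  proof
    show "tob S x y \<in> Ob K" if "x \<in> Ob K" "y \<in> Ob K" for x y
      using that by (simp add: Ob_K tob_K tob_Ob)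
    show "tar S f f' \<in> hom K (tob S x x') (tob S y y')"
      if "f \<in> hom K x y" "f' \<in> hom K x' y'" for f f' x y x' y'
      using that by (elim hom_KE) (simp add: tar_K tob_K tar_hom G_hom)
    show "tar S (Id K x) (Id K y) = Id K (tob S x y)" if "x \<in> Ob K" "y \<in> Ob K" for x y
      using that by (simp add: Ob_K Id_K tob_K tob_Ob tar_K[OF Id_hom Id_hom] tar_Id)
    show "tar S (Cmp K f g) (Cmp K f' g') = Cmp K (tar S f f') (tar S g g')"
      if "f \<in> hom K x y" "g \<in> hom K y z" "f' \<in> hom K x' y'" "g' \<in> hom K y' z'"
      for f g f' g' x y z x' y' z'
      using that
      by (elim hom_KE)
        (simp add: Cmp_K tar_K tar_K[OF Cmp_hom Cmp_hom] Cmp_K[OF tar_hom tar_hom] tar_Cmp)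
    show "tunit S \<in> Ob K" by (simp add: tunit_K Ob_K tunit_Ob)
    show "iso_in K (tob S (tob S x y) z) (tob S x (tob S y z)) (tassoc S x y z)"
      if "x \<in> Ob K" "y \<in> Ob K" "z \<in> Ob K" for x y z
      using that by (simp add: Ob_K tob_K tassoc_K tassoc_iso iso_K)
    show "iso_in K (tob S (tunit S) x) x (tleft S x)" if "x \<in> Ob K" for x
      using that by (simp add: Ob_K tob_K tunit_K tleft_K tleft_iso iso_K)
    show "iso_in K (tob S x (tunit S)) x (tright S x)" if "x \<in> Ob K" for x
      using that by (simp add: Ob_K tob_K tunit_K tright_K tright_iso iso_K)
    show "Cmp K (tar S (tar S f g) h) (tassoc S x' y' z') = Cmp K (tassoc S x y z) (tar S f (tar S g h))"
      if "f \<in> hom K x x'" "g \<in> hom K y y'" "h \<in> hom K z z'" for f g h x y z x' y' z'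
      using that
    proof (elim hom_KE)
      fix f0 g0 h0
      assume eqs: "f = G f0" "g = G g0" "h = G h0"
        and h: "f0 \<in> hom D x x'" "g0 \<in> hom D y y'" "h0 \<in> hom D z z'"
      note o = h[THEN hom_Ob(1)] h[THEN hom_Ob(2)]
      note t = tar_hom[OF h(1,2)] tar_hom[OF h(2,3)]
      show ?thesis
        \<comment> \<open>These instances pull \<open>G\<close> out of both composites; what remains
          under \<open>G\<close> is naturality in \<open>D\<close>.\<close>
        using Cmp_K[OF tar_hom[OF t(1) h(3)] iso_hom[OF tassoc_iso[OF o(4-6)]]]
          Cmp_K[OF iso_hom[OF tassoc_iso[OF o(1-3)]] tar_hom[OF h(1) t(2)]]
        by (simp add: eqs tassoc_K o tar_K[OF h(1,2)] tar_K[OF h(2,3)] tar_K[OF t(1) h(3)]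
            tar_K[OF h(1) t(2)] tassoc_natural[OF h])
    qed
    show "Cmp K (tar S (Id K (tunit S)) f) (tleft S y) = Cmp K (tleft S x) f"
      if "f \<in> hom K x y" for f x y
      using that
    proof (elim hom_KE)
      fix f0 assume eqs: "f = G f0" and h: "f0 \<in> hom D x y"
      note o = hom_Ob[OF h]
      note i = Id_hom[OF tunit_Ob]
      show ?thesis
        using Cmp_K[OF tar_hom[OF i h] iso_hom[OF tleft_iso[OF o(2)]]]
          Cmp_K[OF iso_hom[OF tleft_iso[OF o(1)]] h]
        by (simp add: eqs o tleft_K tunit_K Id_K tunit_Ob tar_K[OF i h] tleft_natural[OF h])
    qed
    show "Cmp K (tar S f (Id K (tunit S))) (tright S y) = Cmp K (tright S x) f"
      if "f \<in> hom K x y" for f x y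
      using that
    proof (elim hom_KE)
      fix f0 assume eqs: "f = G f0" and h: "f0 \<in> hom D x y"
      note o = hom_Ob[OF h]
      note i = Id_hom[OF tunit_Ob]
      show ?thesis
        using Cmp_K[OF tar_hom[OF h i] iso_hom[OF tright_iso[OF o(2)]]]
          Cmp_K[OF iso_hom[OF tright_iso[OF o(1)]] h]
        by (simp add: eqs o tright_K tunit_K Id_K tunit_Ob tar_K[OF h i] tright_natural[OF h])
    qed
    show "Cmp K (tassoc S (tob S w x) y z) (tassoc S w x (tob S y z))
        = Cmp K (Cmp K (tar S (tassoc S w x y) (Id K z)) (tassoc S w (tob S x y) z))
                (tar S (Id K w) (tassoc S x y z))"
      if "w \<in> Ob K" "x \<in> Ob K" "y \<in> Ob K" "z \<in> Ob K" for w x y z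
    proof -
      note o = that[unfolded Ob_K]
      note a = iso_hom[OF tassoc_iso]
      \<comment> \<open>The five associators of the pentagon. Their typings allow
        \<open>Cmp_K\<close> and \<open>tar_K\<close> to move \<open>G\<close> outside each
        side.\<close>
      note a1 = a[OF tob_Ob[OF o(1,2)] o(3,4)] and a2 = a[OF o(1,2) tob_Ob[OF o(3,4)]]
        and a3 = a[OF o(1,2,3)] and a4 = a[OF o(1) tob_Ob[OF o(2,3)] o(4)] and a5 = a[OF o(2,3,4)]
      note iz = Id_hom[OF o(4)] and iw = Id_hom[OF o(1)]
      show ?thesis
        using pentagon[OF o]
        by (simp add: tassoc_K o tob_Ob tob_K Id_K tar_K[OF a3 iz] tar_K[OF iw a5]
            Cmp_K[OF a1 a2] Cmp_K[OF tar_hom[OF a3 iz] a4]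
            Cmp_K[OF Cmp_hom[OF tar_hom[OF a3 iz] a4] tar_hom[OF iw a5]])
    qed
    show "Cmp K (tassoc S x (tunit S) y) (tar S (Id K x) (tleft S y)) = tar S (tright S x) (Id K y)"
      if "x \<in> Ob K" "y \<in> Ob K" for x y
    proof -
      note o = that[unfolded Ob_K]
      note a = iso_hom[OF tassoc_iso[OF o(1) tunit_Ob o(2)]]
        and l = iso_hom[OF tleft_iso[OF o(2)]] and r = iso_hom[OF tright_iso[OF o(1)]]
      note ix = Id_hom[OF o(1)] and iy = Id_hom[OF o(2)]
      show ?thesis
        using triangle[OF o]
        by (simp add: tassoc_K tunit_Ob tunit_K tleft_K tright_K Id_K o tar_K[OF ix l] tar_K[OF r iy]
            Cmp_K[OF a tar_hom[OF ix l]])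
    qed
  qed
qed

section \<open>The monoidal equivalence given by the transport\<close>

definition transport_functor :: "('o, 'k, 'o, 'm) functor_data" where
  "transport_functor = \<lparr>fob = (\<lambda>x. x), far = F\<rparr>"

definition transport_inverse :: "('o, 'm, 'o, 'k) functor_data" where
  "transport_inverse = \<lparr>fob = (\<lambda>x. x), far = G\<rparr>"

lemma functor_F: "is_functor K D transport_functor"
proof -
  interpret K: category K by (rule category_K)
  show ?thesis
  proof
    show "far transport_functor (Cmp K f g) = Cmp D (far transport_functor f) (far transport_functor g)"
      if "f \<in> hom K x y" "g \<in> hom K y z" for f g x y z
      using that by (elim hom_KE) (simp add: transport_functor_def Cmp_K F_G F_G[OF Cmp_hom])
  qed (simp_all add: transport_functor_def Ob_K F_hom Id_K F_G[OF Id_hom])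
qed

lemma functor_G: "is_functor D K transport_inverse"
proof -
  interpret K: category K by (rule category_K)
  show ?thesis
    by unfold_locales (simp_all add: transport_inverse_def Ob_K G_hom Id_K Cmp_K)
qed

text \<open>The two functors are mutually inverse and fix objects, so identities serve as unit and
  counit.\<close>

lemma equivalence_transport:
  "equivalence K D transport_functor transport_inverse (Id K) (Id D)"
proof -
  interpret K: category K by (rule category_K)
  interpret F: is_functor K D transport_functor by (rule functor_F)
  interpret G: is_functor D K transport_inverse by (rule functor_G)
  show ?thesis
  proof
    show "iso_in K (fob id_functor x) (fob (comp_functor transport_functor transport_inverse) x) (Id K x)"
      if "x \<in> Ob K" for x
      using that iso_K[OF iso_Id, of x]
      by (simp add: id_functor_def comp_functor_def transport_functor_def transport_inverse_def Ob_K Id_K)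
    show "iso_in D (fob (comp_functor transport_inverse transport_functor) x) (fob id_functor x) (Id D x)"
      if "x \<in> Ob D" for x
      using that iso_Id[of x]
      by (simp add: id_functor_def comp_functor_def transport_functor_def transport_inverse_def)
  qed (simp_all add: id_functor_def comp_functor_def transport_functor_def transport_inverse_def
      Ob_K F_hom G_hom F_G G_F Id_K F_G[OF Id_hom] K.Id_left K.Id_right Id_left Id_right
      K.Id_hom K.Cmp_hom Cmp_hom Id_hom F_G[OF Cmp_hom] G_F[OF K.Cmp_hom])
qed

text \<open>Tensor products and unit objects agree on both sides, and \<open>F\<close> undoes the
  \<open>G\<close> in every piece of structure. The functor is thus strict, with identities as
  comparison morphisms.\<close>

lemma strong_monoidal_transport:
  "strong_monoidal_functor K S D T transport_functor (\<lambda>x y. Id D (tob T x y)) (Id D (tunit T))"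
proof -
  interpret KM: monoidal_category K S by (rule monoidal_K)
  interpret F: is_functor K D transport_functor by (rule functor_F)
  note [simp] = transport_functor_def Ob_K tob_K tunit_K tob_Ob tunit_Ob
  show ?thesis
  proof
    show "iso_in D (tob T (fob transport_functor x) (fob transport_functor y))
        (fob transport_functor (tob S x y)) (Id D (tob T x y))" if "x \<in> Ob K" "y \<in> Ob K" for x y
      using that by (simp add: iso_Id)
    show "Cmp D (tar T (far transport_functor f) (far transport_functor f')) (Id D (tob T y y'))
        = Cmp D (Id D (tob T x x')) (far transport_functor (tar S f f'))"
      if "f \<in> hom K x y" "f' \<in> hom K x' y'" for f f' x y x' y'
      using that
    proof (elim hom_KE)
      fix f0 f0' assume "f = G f0" "f' = G f0'" and h: "f0 \<in> hom D x y" "f0' \<in> hom D x' y'"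
      then show ?thesis
        by (simp add: F_G[OF h(1)] F_G[OF h(2)] tar_K[OF h] F_G[OF tar_hom[OF h]]
            Id_left[OF tar_hom[OF h]] Id_right[OF tar_hom[OF h]])
    qed
    show "iso_in D (tunit T) (fob transport_functor (tunit S)) (Id D (tunit T))"
      by (simp add: iso_Id)
    show "Cmp D (Cmp D (tar T (Id D (tob T x y)) (Id D (fob transport_functor z)))
            (Id D (tob T (tob S x y) z))) (far transport_functor (tassoc S x y z))
        = Cmp D (Cmp D (tassoc T (fob transport_functor x) (fob transport_functor y)
            (fob transport_functor z)) (tar T (Id D (fob transport_functor x)) (Id D (tob T y z))))
            (Id D (tob T x (tob S y z)))"
      if "x \<in> Ob K" "y \<in> Ob K" "z \<in> Ob K" for x y z
    proof -
      note o = that[unfolded Ob_K]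
      note a = iso_hom[OF tassoc_iso[OF o]]
      show ?thesis
        by (simp add: o tar_Id Id_left[OF Id_hom] tassoc_K F_G[OF a] Id_left[OF a] Id_right[OF a])
    qed
    show "Cmp D (Cmp D (tar T (Id D (tunit T)) (Id D (fob transport_functor x)))
        (Id D (tob T (tunit S) x))) (far transport_functor (tleft S x)) = tleft T (fob transport_functor x)"
      if "x \<in> Ob K" for x
    proof -
      note o = that[unfolded Ob_K]
      note a = iso_hom[OF tleft_iso[OF o]]
      show ?thesis
        by (simp add: o tar_Id Id_left[OF Id_hom] tleft_K F_G[OF a] Id_left[OF a])
    qed
    show "Cmp D (Cmp D (tar T (Id D (fob transport_functor x)) (Id D (tunit T)))
        (Id D (tob T x (tunit S)))) (far transport_functor (tright S x)) = tright T (fob transport_functor x)"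
      if "x \<in> Ob K" for x
    proof -
      note o = that[unfolded Ob_K]
      note a = iso_hom[OF tright_iso[OF o]]
      show ?thesis
        by (simp add: o tar_Id Id_left[OF Id_hom] tright_K F_G[OF a] Id_left[OF a])
    qed
  qed
qed

end

section \<open>Monoidal categories of matrices\<close>

definition mat_cat ::
  "'o set \<Rightarrow> ('o \<Rightarrow> 'u set) \<Rightarrow> ('o \<Rightarrow> 'o \<Rightarrow> ('u \<Rightarrow> 'u \<Rightarrow> real) \<Rightarrow> bool)
     \<Rightarrow> ('o, ('o, 'u \<Rightarrow> 'u \<Rightarrow> real) arrow) cat_data" where
  "mat_cat obs U adm = \<lparr>
     Ob = obs,
     Ar = {Arrow A M B | A M B. A \<in> obs \<and> B \<in> obs \<and> M \<in> submat (U A) (U B) \<and> adm A B M},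
     Dom = asrc, Cod = atgt,
     Id = (\<lambda>A. Arrow A (mat_id (U A)) A),
     Cmp = (\<lambda>a b. Arrow (asrc a) (mat_mult (amap a) (amap b)) (atgt b))\<rparr>"

definition mat_tensor ::
  "'u universe \<Rightarrow> ('o \<Rightarrow> 'u set) \<Rightarrow> ('o \<Rightarrow> 'o \<Rightarrow> 'o) \<Rightarrow> 'o
     \<Rightarrow> ('o, ('o, 'u \<Rightarrow> 'u \<Rightarrow> real) arrow) tensor_data" where
  "mat_tensor V U P E = \<lparr>
     tob = P,
     tar = (\<lambda>a b. Arrow (P (asrc a) (asrc b)) (kron V (amap a) (amap b)) (P (atgt a) (atgt b))),
     tunit = E,
     tassoc = (\<lambda>A B C. Arrow (P (P A B) C)
       (fun_mat (uprod V (uprod V (U A) (U B)) (U C)) (assoc_fun V (U A) (U B) (U C))) (P A (P B C))),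
     tleft = (\<lambda>A. Arrow (P E A) (fun_mat (uprod V {upoint V} (U A)) (left_fun V (U A))) A),
     tright = (\<lambda>A. Arrow (P A E) (fun_mat (uprod V (U A) {upoint V}) (right_fun V (U A))) A)\<rparr>"

text \<open>Defined without a domain, because \<open>fun_mat\<close> imposes one; it witnesses
  bijectivity in \<open>bij_assoc\<close>.\<close>

definition assoc_inv_fun :: "'u universe \<Rightarrow> 'u \<Rightarrow> 'u" where
  "assoc_inv_fun V w = upair V (upair V (ufst V w, ufst V (usnd V w)), usnd V (usnd V w))"

context set_universe
begin

lemma assoc_fun_upair [simp]:
  "x \<in> X \<Longrightarrow> y \<in> Y \<Longrightarrow> z \<in> Z \<Longrightarrow>
    assoc_fun V X Y Z (upair V (upair V (x, y), z)) = upair V (x, upair V (y, z))"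
  by (simp add: assoc_fun_def)

lemma assoc_inv_fun_upair [simp]:
  "assoc_inv_fun V (upair V (x, upair V (y, z))) = upair V (upair V (x, y), z)"
  by (simp add: assoc_inv_fun_def)

lemma left_fun_upair [simp]: "x \<in> X \<Longrightarrow> left_fun V X (upair V (upoint V, x)) = x"
  and right_fun_upair [simp]: "x \<in> X \<Longrightarrow> right_fun V X (upair V (x, upoint V)) = x"
  by (simp_all add: left_fun_def right_fun_def)

lemma bij_assoc: "bij_betw (assoc_fun V X Y Z) (uprod V (uprod V X Y) Z) (uprod V X (uprod V Y Z))"
  by (rule bij_betw_byWitness[where f' = "assoc_inv_fun V"]) (auto elim!: uprodE)

lemma bij_left: "bij_betw (left_fun V X) (uprod V {upoint V} X) X"
  by (rule bij_betw_byWitness[where f' = "\<lambda>x. upair V (upoint V, x)"]) (auto elim!: uprodE)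

lemma bij_right: "bij_betw (right_fun V X) (uprod V X {upoint V}) X"
  by (rule bij_betw_byWitness[where f' = "\<lambda>x. upair V (x, upoint V)"]) (auto elim!: uprodE)

lemmas structure_fun_maps =
  bij_assoc[THEN bij_betw_imp_funcset] bij_left[THEN bij_betw_imp_funcset]
  bij_right[THEN bij_betw_imp_funcset]

end

text \<open>The predicate \<open>adm\<close> has to contain the identities and constraints and be
  closed under both products. The inverses of the constraints are listed as well, since an
  admissible invertible matrix may have an inverse that violates a general
  \<open>adm\<close>.\<close>

locale matrix_structure = set_universe V
  for V :: "'u universe" +
  fixes obs :: "'o set" and U :: "'o \<Rightarrow> 'u set"
    and adm :: "'o \<Rightarrow> 'o \<Rightarrow> ('u \<Rightarrow> 'u \<Rightarrow> real) \<Rightarrow> bool"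
    and P :: "'o \<Rightarrow> 'o \<Rightarrow> 'o" and E :: 'o
  assumes P_obs: "A \<in> obs \<Longrightarrow> B \<in> obs \<Longrightarrow> P A B \<in> obs"
    and E_obs: "E \<in> obs"
    and U_P: "U (P A B) = uprod V (U A) (U B)"
    and U_E: "U E = {upoint V}"
    and adm_id: "A \<in> obs \<Longrightarrow> adm A A (mat_id (U A))"
    and adm_mult: "\<lbrakk>A \<in> obs; B \<in> obs; C \<in> obs; M \<in> submat (U A) (U B); N \<in> submat (U B) (U C);
        adm A B M; adm B C N\<rbrakk> \<Longrightarrow> adm A C (mat_mult M N)"
    and adm_kron: "\<lbrakk>A \<in> obs; B \<in> obs; A' \<in> obs; B' \<in> obs; M \<in> submat (U A) (U B);
        M' \<in> submat (U A') (U B'); adm A B M; adm A' B' M'\<rbrakk>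
        \<Longrightarrow> adm (P A A') (P B B') (kron V M M')"
    and adm_assoc: "\<lbrakk>A \<in> obs; B \<in> obs; C \<in> obs\<rbrakk> \<Longrightarrow> adm (P (P A B) C) (P A (P B C))
        (fun_mat (uprod V (uprod V (U A) (U B)) (U C)) (assoc_fun V (U A) (U B) (U C)))"
    and adm_assoc_inv: "\<lbrakk>A \<in> obs; B \<in> obs; C \<in> obs\<rbrakk> \<Longrightarrow> adm (P A (P B C)) (P (P A B) C)
        (fun_mat (uprod V (U A) (uprod V (U B) (U C))) (assoc_inv_fun V))"
    and adm_left: "A \<in> obs \<Longrightarrow> adm (P E A) A (fun_mat (uprod V {upoint V} (U A)) (left_fun V (U A)))"
    and adm_left_inv: "A \<in> obs \<Longrightarrow> adm A (P E A) (fun_mat (U A) (\<lambda>x. upair V (upoint V, x)))"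
    and adm_right: "A \<in> obs \<Longrightarrow> adm (P A E) A (fun_mat (uprod V (U A) {upoint V}) (right_fun V (U A)))"
    and adm_right_inv: "A \<in> obs \<Longrightarrow> adm A (P A E) (fun_mat (U A) (\<lambda>x. upair V (x, upoint V)))"
begin

abbreviation "C \<equiv> mat_cat obs U adm"
abbreviation "T \<equiv> mat_tensor V U P E"

lemma Arrow_hom: "Arrow A' M B' \<in> hom C A B \<longleftrightarrow>
    A' = A \<and> B' = B \<and> A \<in> obs \<and> B \<in> obs \<and> M \<in> submat (U A) (U B) \<and> adm A B M"
  by (auto simp: mat_cat_def hom_def)

lemma homE:
  assumes "f \<in> hom C A B"
  obtains M where "f = Arrow A M B" "A \<in> obs" "B \<in> obs" "M \<in> submat (U A) (U B)" "adm A B M"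
  using assms by (cases f) (auto simp: Arrow_hom)

lemma C_simps [simp]:
  "Ob C = obs" "Id C A = Arrow A (mat_id (U A)) A"
  "Cmp C (Arrow A M B) (Arrow A' M' B') = Arrow A (mat_mult M M') B'"
  by (simp_all add: mat_cat_def)

lemma T_simps [simp]:
  "tob T = P" "tunit T = E"
  "tar T (Arrow A M B) (Arrow A' M' B') = Arrow (P A A') (kron V M M') (P B B')"
  "tassoc T A B D = Arrow (P (P A B) D)
     (fun_mat (uprod V (uprod V (U A) (U B)) (U D)) (assoc_fun V (U A) (U B) (U D))) (P A (P B D))"
  "tleft T A = Arrow (P E A) (fun_mat (uprod V {upoint V} (U A)) (left_fun V (U A))) A"
  "tright T A = Arrow (P A E) (fun_mat (uprod V (U A) {upoint V}) (right_fun V (U A))) A"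
  by (simp_all add: mat_tensor_def)

lemma category_C: "category C"
proof
  show "Dom C f \<in> Ob C" "Cod C f \<in> Ob C" if "f \<in> Ar C" for f
    using that by (auto simp: mat_cat_def)
  show "Id C A \<in> hom C A A" if "A \<in> Ob C" for A
    using that by (simp add: Arrow_hom mat_id_submat adm_id)
  show "Cmp C f g \<in> hom C x z" if "f \<in> hom C x y" "g \<in> hom C y z" for f g x y z
    using that by (elim homE) (auto simp: Arrow_hom intro: mat_mult_submat adm_mult)
  show "Cmp C (Id C x) f = f" "Cmp C f (Id C y) = f" if "f \<in> hom C x y" for f x y
    using that by (auto elim!: homE simp: mat_mult_id_left mat_mult_id_right)
  show "Cmp C (Cmp C f g) h = Cmp C f (Cmp C g h)"
    if "f \<in> hom C w x" "g \<in> hom C x y" "h \<in> hom C y z" for f g h w x y z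
    using that by (auto elim!: homE simp: mat_mult_assoc)
qed

lemma iso_fun_mat:
  assumes "A \<in> obs" "B \<in> obs" "f \<in> U A \<rightarrow> U B" "g \<in> U B \<rightarrow> U A"
    and "\<And>x. x \<in> U A \<Longrightarrow> g (f x) = x" "\<And>y. y \<in> U B \<Longrightarrow> f (g y) = y"
    and "adm A B (fun_mat (U A) f)" "adm B A (fun_mat (U B) g)"
  shows "iso_in C A B (Arrow A (fun_mat (U A) f) B)"
  unfolding iso_in_def
proof (intro conjI bexI)
  show "Arrow A (fun_mat (U A) f) B \<in> hom C A B" "Arrow B (fun_mat (U B) g) A \<in> hom C B A"
    using assms by (simp_all add: Arrow_hom fun_mat_submat)
  show "Cmp C (Arrow A (fun_mat (U A) f) B) (Arrow B (fun_mat (U B) g) A) = Id C A"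
    "Cmp C (Arrow B (fun_mat (U B) g) A) (Arrow A (fun_mat (U A) f) B) = Id C B"
    using assms by (simp_all add: fun_mat_comp mat_id_fun_mat cong: fun_mat_cong)
qed

lemma monoidal_C: "monoidal_category C T"
proof -
  interpret C: category C by (rule category_C)
  note [simp] = U_P U_E
  show ?thesis
  proof
    show "tob T x y \<in> Ob C" if "x \<in> Ob C" "y \<in> Ob C" for x y
      using that by (simp add: P_obs)
    show "tar T f f' \<in> hom C (tob T x x') (tob T y y')"
      if "f \<in> hom C x y" "f' \<in> hom C x' y'" for f f' x y x' y'
      using that by (auto elim!: homE simp: Arrow_hom P_obs kron_submat adm_kron)
    show "tar T (Id C x) (Id C y) = Id C (tob T x y)" if "x \<in> Ob C" "y \<in> Ob C" for x y
      by (simp add: kron_id)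
    show "tar T (Cmp C f g) (Cmp C f' g') = Cmp C (tar T f f') (tar T g g')"
      if "f \<in> hom C x y" "g \<in> hom C y z" "f' \<in> hom C x' y'" "g' \<in> hom C y' z'"
      for f g f' g' x y z x' y' z'
      using that by (auto elim!: homE simp: kron_mult)
    show "tunit T \<in> Ob C" by (simp add: E_obs)
    show "iso_in C (tob T (tob T x y) z) (tob T x (tob T y z)) (tassoc T x y z)"
      if "x \<in> Ob C" "y \<in> Ob C" "z \<in> Ob C" for x y z
    proof -
      \<comment> \<open>Stated with \<open>U\<close> of the composite object, to match
        \<open>iso_fun_mat\<close>; rewriting with \<open>U_P\<close> then gives the form in
        \<open>mat_tensor\<close>.\<close>
      have "iso_in C (P (P x y) z) (P x (P y z)) (Arrow (P (P x y) z)
          (fun_mat (U (P (P x y) z)) (assoc_fun V (U x) (U y) (U z))) (P x (P y z)))"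
        by (rule iso_fun_mat[where g = "assoc_inv_fun V"])
          (use that in \<open>auto simp: P_obs adm_assoc adm_assoc_inv elim!: uprodE\<close>)
      then show ?thesis by simp
    qed
    show "iso_in C (tob T (tunit T) x) x (tleft T x)" if "x \<in> Ob C" for x
    proof -
      have "iso_in C (P E x) x (Arrow (P E x) (fun_mat (U (P E x)) (left_fun V (U x))) x)"
        by (rule iso_fun_mat[where g = "\<lambda>u. upair V (upoint V, u)"])
          (use that in \<open>auto simp: P_obs E_obs adm_left adm_left_inv elim!: uprodE\<close>)
      then show ?thesis by simp
    qed
    show "iso_in C (tob T x (tunit T)) x (tright T x)" if "x \<in> Ob C" for x
    proof -
      have "iso_in C (P x E) x (Arrow (P x E) (fun_mat (U (P x E)) (right_fun V (U x))) x)"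
        by (rule iso_fun_mat[where g = "\<lambda>u. upair V (u, upoint V)"])
          (use that in \<open>auto simp: P_obs E_obs adm_right adm_right_inv elim!: uprodE\<close>)
      then show ?thesis by simp
    qed
    show "Cmp C (tar T (tar T f g) h) (tassoc T x' y' z')
        = Cmp C (tassoc T x y z) (tar T f (tar T g h))"
      if "f \<in> hom C x x'" "g \<in> hom C y y'" "h \<in> hom C z z'" for f g h x y z x' y' z'
      using that
    proof (elim homE)
      fix L M N
      assume eqs: "f = Arrow x L x'" "g = Arrow y M y'" "h = Arrow z N z'"
        and m: "L \<in> submat (U x) (U x')" "M \<in> submat (U y) (U y')" "N \<in> submat (U z) (U z')"
      \<comment> \<open>The associator only regroups index triples, and the corresponding entries on
        both sides are products of the same three entries of \<open>L\<close>, \<open>M\<close> and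
        \<open>N\<close>.\<close>
      show ?thesis
        unfolding eqs
        by (simp, rule fun_mat_natural[OF kron_submat[OF kron_submat[OF m(1,2)] m(3)]
              kron_submat[OF m(1) kron_submat[OF m(2,3)]] structure_fun_maps(1) bij_assoc])
          (auto elim!: uprodE)
    qed
    show "Cmp C (tar T (Id C (tunit T)) f) (tleft T y) = Cmp C (tleft T x) f"
      if "f \<in> hom C x y" for f x y
      using that
    proof (elim homE)
      fix M assume eqs: "f = Arrow x M y" and m: "M \<in> submat (U x) (U y)"
      \<comment> \<open>The unit factor contributes the single entry 1 of \<open>mat_id\<close> at
        \<open>upoint V\<close>.\<close>
      show ?thesis
        unfolding eqs
        by (simp, rule fun_mat_natural[OF kron_submat[OF mat_id_submat m] m
              structure_fun_maps(2) bij_left])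
          (auto elim!: uprodE simp: mat_id_def)
    qed
    show "Cmp C (tar T f (Id C (tunit T))) (tright T y) = Cmp C (tright T x) f"
      if "f \<in> hom C x y" for f x y
      using that
    proof (elim homE)
      fix M assume eqs: "f = Arrow x M y" and m: "M \<in> submat (U x) (U y)"
      show ?thesis
        unfolding eqs
        by (simp, rule fun_mat_natural[OF kron_submat[OF m mat_id_submat] m
              structure_fun_maps(3) bij_right])
          (auto elim!: uprodE simp: mat_id_def)
    qed
    show "Cmp C (tassoc T (tob T w x) y z) (tassoc T w x (tob T y z))
        = Cmp C (Cmp C (tar T (tassoc T w x y) (Id C z)) (tassoc T w (tob T x y) z))
                (tar T (Id C w) (tassoc T x y z))" for w x y z
    proof -
      let ?W = "U w" let ?X = "U x" let ?Y = "U y" let ?Z = "U z"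
      \<comment> \<open>All arrows of the pentagon are matrices of functions, so it becomes an
        equation between functions on nested pairs. Facts \<open>1\<close> and \<open>2\<close> type
        the first arrow of the right-hand side and its composite with the second, for
        \<open>fun_mat_comp\<close>.\<close>
      have 1: "(\<lambda>u. upair V (assoc_fun V ?W ?X ?Y (ufst V u), usnd V u))
          \<in> uprod V (uprod V (uprod V ?W ?X) ?Y) ?Z \<rightarrow> uprod V (uprod V ?W (uprod V ?X ?Y)) ?Z"
        by (auto elim!: uprodE)
      have 2: "(\<lambda>u. assoc_fun V ?W (uprod V ?X ?Y) ?Z (upair V (assoc_fun V ?W ?X ?Y (ufst V u), usnd V u)))
          \<in> uprod V (uprod V (uprod V ?W ?X) ?Y) ?Z \<rightarrow> uprod V ?W (uprod V (uprod V ?X ?Y) ?Z)"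
        by (auto elim!: uprodE)
      show ?thesis
        by (simp add: mat_id_fun_mat kron_fun_mat fun_mat_comp[OF structure_fun_maps(1)]
            fun_mat_comp[OF 1] fun_mat_comp[OF 2])
          (rule fun_mat_cong, auto elim!: uprodE)
    qed
    show "Cmp C (tassoc T x (tunit T) y) (tar T (Id C x) (tleft T y)) = tar T (tright T x) (Id C y)"
      for x y
      by (simp add: mat_id_fun_mat kron_fun_mat fun_mat_comp[OF structure_fun_maps(1)])
        (rule fun_mat_cong, auto elim!: uprodE)
  qed
qed

end

section \<open>Partitioned matrices\<close>

definition mass :: "('u \<Rightarrow> real) \<Rightarrow> 'u set \<Rightarrow> real" where
  "mass p S = (\<Sum>x\<in>supp p \<inter> S. p x)"

lemma sub_equiv_mass:
  "sub_equiv A p q \<longleftrightarrow> (\<forall>x\<in>fst A. mass p (snd A `` {x}) = mass q (snd A `` {x}))"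
  by (simp add: sub_equiv_def mass_def)

lemma mass_dirac: "mass (dirac x) S = (if x \<in> S then 1 else 0)"
  by (simp add: mass_def supp_dirac) (simp add: dirac_def)

lemma mass_superset: "finite F \<Longrightarrow> supp p \<subseteq> F \<Longrightarrow> mass p S = (\<Sum>x\<in>F \<inter> S. p x)"
  unfolding mass_def by (rule sum.mono_neutral_left) (auto simp: supp_def)

text \<open>The mass of a set is the product with its indicator vector, so this is associativity.\<close>

lemma mass_vec_mat:
  assumes p: "finite (supp p)" and M: "\<And>x. finite (supp (M x))"
  shows "mass (vec_mat p M) S = (\<Sum>x\<in>supp p. p x * mass (M x) S)"
proof -
  \<comment> \<open>Each column of \<open>N\<close> is the indicator vector of \<open>S\<close>, so
    any column can be read off; \<open>undefined\<close> names an arbitrary one.\<close>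
  define N :: "'a \<Rightarrow> 'a \<Rightarrow> real" where "N = (\<lambda>x _. if x \<in> S then 1 else 0)"
  have mass: "mass q S = vec_mat q N undefined" if "finite (supp q)" for q
    unfolding mass_def vec_mat_def N_def sum.inter_restrict[OF that] by (rule sum.cong) auto
  have "finite (supp (vec_mat p M))"
    by (rule finite_subset[OF supp_vec_mat]) (use assms in blast)
  then have "mass (vec_mat p M) S = vec_mat p (mat_mult M N) undefined"
    by (simp add: mass vec_mat_assoc assms)
  then show ?thesis
    by (simp add: vec_mat_def[of p] mat_mult_row mass[OF M])
qed

text \<open>Grouped by classes, either sum becomes a sum of class masses times the constant value of
  \<open>h\<close> on the class, and \<open>p\<close> and \<open>q\<close> have the same masses.
  Grouping over the union of both supports gives one finite family of classes for the two
  sums.\<close>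

lemma sum_eq_if_sub_equiv:
  assumes A: "equiv X R" and p: "p \<in> subdist X" and q: "q \<in> subdist X"
    and pq: "sub_equiv (X, R) p q" and h: "\<And>x x'. (x, x') \<in> R \<Longrightarrow> h x = h x'"
  shows "(\<Sum>x\<in>supp p. p x * h x) = (\<Sum>x\<in>supp q. q x * h x)"
proof -
  let ?S = "supp p \<union> supp q" let ?c = "\<lambda>x. R `` {x}"
  have fS: "finite ?S" and SX: "?S \<subseteq> X"
    using p q by (auto dest: subdist_finite subdist_supp)
  have fibre: "{x \<in> ?S. ?c x = ?c a} = ?S \<inter> ?c a" if "a \<in> ?S" for a
    using that SX equiv_class_eq_iff[OF A, of a] by auto
  \<comment> \<open>The value of \<open>h\<close> on a class \<open>K\<close> is taken at a chosen
    representative, so that it depends on \<open>K\<close> alone.\<close>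
  have grouped: "(\<Sum>x\<in>supp r. r x * h x) = (\<Sum>K\<in>?c ` ?S. mass r K * h (SOME x. x \<in> K))"
    if r: "supp r \<subseteq> ?S" for r
  proof -
    have "(\<Sum>x\<in>supp r. r x * h x) = (\<Sum>x\<in>?S. r x * h x)"
      by (rule sum.mono_neutral_left[OF fS r]) (simp add: supp_def)
    also have "\<dots> = (\<Sum>K\<in>?c ` ?S. \<Sum>x\<in>{x \<in> ?S. ?c x = K}. r x * h x)"
      using fS by (intro sum.group[symmetric]) auto
    also have "\<dots> = (\<Sum>K\<in>?c ` ?S. mass r K * h (SOME x. x \<in> K))"
    proof (rule sum.cong[OF refl])
      fix K assume "K \<in> ?c ` ?S"
      then obtain a where a: "a \<in> ?S" "K = ?c a" by blast
      have "a \<in> K" using a SX equiv_class_self[OF A] by blast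
      then have some: "(SOME x. x \<in> K) \<in> K" by (rule someI)
      have "h x = h (SOME x. x \<in> K)" if "x \<in> K" for x
        using h[of a x] h[of a "SOME x. x \<in> K"] that some a by simp
      then have "(\<Sum>x\<in>?S \<inter> K. r x * h x) = (\<Sum>x\<in>?S \<inter> K. r x) * h (SOME x. x \<in> K)"
        by (simp add: sum_distrib_right)
      then show "(\<Sum>x\<in>{x \<in> ?S. ?c x = K}. r x * h x) = mass r K * h (SOME x. x \<in> K)"
        using fibre[OF a(1)] a(2) by (simp add: mass_superset[OF fS r])
    qed
    finally show ?thesis .
  qed
  have "mass p K = mass q K" if "K \<in> ?c ` ?S" for K
    using that pq SX by (auto simp: sub_equiv_mass)
  then show ?thesis by (simp add: grouped)
qed

lemma sub_equiv_dirac: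
  assumes "equiv X R" "(x, x') \<in> R"
  shows "sub_equiv (X, R) (dirac x) (dirac x')"
proof -
  have "(a, x) \<in> R \<longleftrightarrow> (a, x') \<in> R" for a
    using assms by (meson equivE symD transD)
  then show ?thesis by (simp add: sub_equiv_mass mass_dirac)
qed

text \<open>Testing on point masses yields the rows. Conversely, by \<open>mass_vec_mat\<close> the
  mass of a class under \<open>vec_mat p M\<close> is a sum of \<open>p x * h x\<close>, where
  \<open>h x\<close> is the mass of that class under row \<open>x\<close>; equivalent rows make
  \<open>h\<close> constant on classes, and \<open>sum_eq_if_sub_equiv\<close> applies.\<close>

lemma partitioned_iff_rows:
  assumes A: "equiv X R" and M: "M \<in> submat X Y"
  shows "partitioned (X, R) B M \<longleftrightarrow> (\<forall>(x, x')\<in>R. sub_equiv B (M x) (M x'))"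
proof
  assume part: "partitioned (X, R) B M"
  have "sub_equiv B (M x) (M x')" if xx': "(x, x') \<in> R" for x x'
  proof -
    have "x \<in> X" "x' \<in> X" using xx' equiv_type[OF A] by auto
    then have "sub_equiv B (vec_mat (dirac x) M) (vec_mat (dirac x') M)"
      using part sub_equiv_dirac[OF A xx'] by (simp add: partitioned_def dirac_subdist)
    then show ?thesis by (simp add: vec_mat_dirac)
  qed
  then show "\<forall>(x, x')\<in>R. sub_equiv B (M x) (M x')" by auto
next
  assume rows: "\<forall>(x, x')\<in>R. sub_equiv B (M x) (M x')"
  show "partitioned (X, R) B M"
    unfolding partitioned_def
  proof (intro ballI impI)
    fix p q assume "p \<in> subdist (fst (X, R))" "q \<in> subdist (fst (X, R))" and pq: "sub_equiv (X, R) p q"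
    then have p: "p \<in> subdist X" and q: "q \<in> subdist X" by simp_all
    note fM = subdist_finite[OF submat_row[OF M]]
    show "sub_equiv B (vec_mat p M) (vec_mat q M)"
      unfolding sub_equiv_mass
    proof
      fix y assume "y \<in> fst B"
      then have "mass (M x) (snd B `` {y}) = mass (M x') (snd B `` {y})" if "(x, x') \<in> R" for x x'
        using rows that by (auto simp: sub_equiv_mass)
      then show "mass (vec_mat p M) (snd B `` {y}) = mass (vec_mat q M) (snd B `` {y})"
        by (simp add: mass_vec_mat subdist_finite[OF p] subdist_finite[OF q] fM
            sum_eq_if_sub_equiv[OF A p q pq])
    qed
  qed
qed

lemma partitioned_id: "partitioned A A (mat_id (fst A))"
  by (simp add: partitioned_def vec_mat_id)

lemma partitioned_mult:
  assumes M: "M \<in> submat (fst A) (fst B)" and N: "N \<in> submat (fst B) (fst C)"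
    and "partitioned A B M" "partitioned B C N"
  shows "partitioned A C (mat_mult M N)"
  unfolding partitioned_def
proof (intro ballI impI)
  fix p q assume p: "p \<in> subdist (fst A)" and q: "q \<in> subdist (fst A)" and pq: "sub_equiv A p q"
  have "sub_equiv C (vec_mat (vec_mat p M) N) (vec_mat (vec_mat q M) N)"
    using assms p q pq by (simp add: partitioned_def vec_mat_subdist)
  then show "sub_equiv C (vec_mat p (mat_mult M N)) (vec_mat q (mat_mult M N))"
    by (simp add: vec_mat_assoc subdist_finite[OF p] subdist_finite[OF q]
        subdist_finite[OF submat_row[OF M]])
qed

text \<open>The rows are point masses, and point masses at equivalent points are equivalent.\<close>

lemma partitioned_fun_mat:
  assumes A: "equiv (fst A) (snd A)" and B: "equiv (fst B) (snd B)"
    and f: "\<And>x x'. (x, x') \<in> snd A \<Longrightarrow> (f x, f x') \<in> snd B"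
  shows "partitioned A B (fun_mat (fst A) f)"
proof -
  have refl: "(x, x) \<in> snd A" if "x \<in> fst A" for x
    using that A by (meson equivE refl_onD)
  have "f \<in> fst A \<rightarrow> fst B"
    using f[OF refl] equiv_type[OF B] by blast
  moreover have "sub_equiv B (fun_mat (fst A) f x) (fun_mat (fst A) f x')" if "(x, x') \<in> snd A" for x x'
    using that equiv_type[OF A] sub_equiv_dirac[OF B f[OF that]] by (auto simp: fun_mat_row)
  ultimately show ?thesis
    using partitioned_iff_rows[OF A fun_mat_submat, of f "fst B" B] by auto
qed

section \<open>Products of equivalence relations and encoded subdistributions\<close>

context set_universe
begin

lemma uprod_rel_upair [simp]:
  "(upair V (x, y), upair V (x', y')) \<in> uprod_rel V R S \<longleftrightarrow> (x, x') \<in> R \<and> (y, y') \<in> S"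
  by (auto simp: uprod_rel_def)

lemma uprod_relE:
  assumes "(w, w') \<in> uprod_rel V R S"
  obtains x y x' y' where "w = upair V (x, y)" "w' = upair V (x', y')" "(x, x') \<in> R" "(y, y') \<in> S"
  using assms by (auto simp: uprod_rel_def)

lemma equiv_uprod_rel:
  assumes "equiv X R" "equiv Y S"
  shows "equiv (uprod V X Y) (uprod_rel V R S)"
proof (rule equivI)
  show "uprod_rel V R S \<subseteq> uprod V X Y \<times> uprod V X Y"
    using equiv_type[OF assms(1)] equiv_type[OF assms(2)] by (auto elim!: uprod_relE)
  show "refl_on (uprod V X Y) (uprod_rel V R S)"
    using assms by (auto simp: refl_on_def equiv_def elim!: uprodE)
  show "sym (uprod_rel V R S)"
    using assms by (auto simp: sym_def equiv_def elim!: uprod_relE)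
  show "trans (uprod_rel V R S)"
  proof (rule transI)
    fix u v w assume "(u, v) \<in> uprod_rel V R S" "(v, w) \<in> uprod_rel V R S"
    then show "(u, w) \<in> uprod_rel V R S"
      using assms by (elim uprod_relE) (auto elim!: equivE dest: transD)
  qed
qed

text \<open>The class of a pair is the product of the two classes, and the mass of a rectangle under
  a product vector factors.\<close>

lemma mass_vec_kron:
  "mass (vec_kron p q) (uprod_rel V R S `` {upair V (y, v)}) = mass p (R `` {y}) * mass q (S `` {v})"
proof -
  have "supp (vec_kron p q) \<inter> uprod_rel V R S `` {upair V (y, v)}
      = upair V ` ((supp p \<inter> R `` {y}) \<times> (supp q \<inter> S `` {v}))"
    by (auto simp: supp_vec_kron elim!: uprod_relE)
  then show ?thesis by (simp add: mass_def sum_upair sum_product)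
qed

text \<open>A subdistribution on a product of sets need not be a product of subdistributions. The
  row criterion avoids this: rows of a Kronecker product do factor, and \<open>mass_vec_kron\<close>
  handles each factor separately.\<close>

lemma partitioned_kron:
  assumes A: "equiv (fst A) (snd A)" and A': "equiv (fst A') (snd A')"
    and M: "M \<in> submat (fst A) (fst B)" and M': "M' \<in> submat (fst A') (fst B')"
    and p: "partitioned A B M" and p': "partitioned A' B' M'"
  shows "partitioned (pprod V A A') (pprod V B B') (kron V M M')"
  unfolding pprod_def[of V A] partitioned_iff_rows[OF equiv_uprod_rel[OF A A'] kron_submat[OF M M']]
proof clarify
  fix w w' assume "(w, w') \<in> uprod_rel V (snd A) (snd A')"
  then obtain x u x' u' where w: "w = upair V (x, u)" "w' = upair V (x', u')"
    and r: "(x, x') \<in> snd A" "(u, u') \<in> snd A'"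
    by (rule uprod_relE)
  have "sub_equiv B (M x) (M x')" "sub_equiv B' (M' u) (M' u')"
    using p p' r partitioned_iff_rows[OF A M, of B] partitioned_iff_rows[OF A' M', of B'] by auto
  then show "sub_equiv (pprod V B B') (kron V M M' w) (kron V M M' w')"
    by (auto simp: w sub_equiv_mass pprod_def mass_vec_kron elim!: uprodE)
qed

lemma the_dist_udist: "p \<in> subdist X \<Longrightarrow> the_dist V (udist V p) = p"
  unfolding the_dist_def by (rule inv_into_f_f[OF udist_inj subdist_UNIV])

lemma udist_the_dist: "e \<in> usubdist V X \<Longrightarrow> udist V (the_dist V e) = e"
  by (auto simp: usubdist_def the_dist_udist)

lemma the_dist_subdist: "e \<in> usubdist V X \<Longrightarrow> the_dist V e \<in> subdist X"
  by (auto simp: usubdist_def the_dist_udist)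

lemma udist_usubdist: "p \<in> subdist X \<Longrightarrow> udist V p \<in> usubdist V X"
  by (simp add: usubdist_def)

lemma psubdist_rel:
  "(e, e') \<in> snd (psubdist V A) \<longleftrightarrow> e \<in> usubdist V (fst A) \<and> e' \<in> usubdist V (fst A) \<and>
     sub_equiv A (the_dist V e) (the_dist V e')"
  unfolding psubdist_def usubdist_def by (fastforce simp: the_dist_udist)

lemma pSet_ob_iff: "A \<in> pSet_ob V \<longleftrightarrow> fst A \<in> usets V \<and> equiv (fst A) (snd A)"
  by (auto simp: pSet_ob_def)

lemma pprod_ob: "A \<in> pSet_ob V \<Longrightarrow> B \<in> pSet_ob V \<Longrightarrow> pprod V A B \<in> pSet_ob V"
  by (simp add: pSet_ob_iff pprod_def uprod_usets equiv_uprod_rel)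

lemma pone_ob: "pone V \<in> pSet_ob V"
  by (auto simp: pSet_ob_iff pone_def upoint_usets intro!: equivI refl_onI symI transI)

lemma psubdist_ob: "A \<in> pSet_ob V \<Longrightarrow> psubdist V A \<in> pSet_ob V"
proof -
  assume A: "A \<in> pSet_ob V"
  have "equiv (usubdist V (fst A)) (snd (psubdist V A))"
    by (rule equivI) (auto simp: refl_on_def sym_def trans_def psubdist_rel sub_equiv_def)
  then show ?thesis using A by (simp add: pSet_ob_iff psubdist_def usubdist_usets)
qed

section \<open>Kleisli morphisms as matrices\<close>

text \<open>Arrows of sets are extensional, hence \<open>undefined\<close> off \<open>X\<close>,
  whereas matrices vanish there. \<open>mat_fun\<close> and \<open>fun_rows\<close> exchange these
  defaults, which makes them mutually inverse.\<close>

definition mat_fun :: "'u set \<Rightarrow> ('u \<Rightarrow> 'u \<Rightarrow> real) \<Rightarrow> 'u \<Rightarrow> 'u" where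
  "mat_fun X M = (\<lambda>x\<in>X. udist V (M x))"

definition fun_rows :: "'u set \<Rightarrow> ('u \<Rightarrow> 'u) \<Rightarrow> 'u \<Rightarrow> 'u \<Rightarrow> real" where
  "fun_rows X f = (\<lambda>x. if x \<in> X then the_dist V (f x) else (\<lambda>_. 0))"

lemma mat_fun_funcset: "M \<in> submat X Y \<Longrightarrow> mat_fun X M \<in> X \<rightarrow>\<^sub>E usubdist V Y"
  by (simp add: mat_fun_def udist_usubdist[OF submat_row])

lemma fun_rows_submat: "f \<in> X \<rightarrow>\<^sub>E usubdist V Y \<Longrightarrow> fun_rows X f \<in> submat X Y"
  by (auto simp: fun_rows_def submat_def intro!: the_dist_subdist)

lemma fun_rows_mat_fun: "M \<in> submat X Y \<Longrightarrow> fun_rows X (mat_fun X M) = M"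
  by (rule ext) (auto simp: fun_rows_def mat_fun_def the_dist_udist[OF submat_row] submat_def)

lemma mat_fun_fun_rows: "f \<in> X \<rightarrow>\<^sub>E usubdist V Y \<Longrightarrow> mat_fun X (fun_rows X f) = f"
  by (rule ext) (auto simp: fun_rows_def mat_fun_def PiE_iff extensional_def restrict_def udist_the_dist)

lemma unit_fun_mat: "unit_fun V X = mat_fun X (mat_id X)"
  by (rule ext) (simp add: unit_fun_def mat_fun_def mat_id_fun_mat fun_mat_row)

text \<open>A Kleisli constraint is a structure function followed by the unit of the monad, so this
  identifies it with the matrix of that function.\<close>

lemma unit_fun_comp: "f \<in> X \<rightarrow> Y \<Longrightarrow> compose X (unit_fun V Y) f = mat_fun X (fun_mat X f)"
  by (rule ext) (auto simp: compose_def unit_fun_def mat_fun_def fun_mat_row)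

text \<open>Both ingredients of Kleisli composition are vector-matrix products: pushing forward
  multiplies by the matrix of the second function, and the monad multiplication multiplies by the
  decoding. The product of these two matrices agrees with \<open>N\<close> on
  \<open>Y\<close>.\<close>

lemma kleisli_comp_mat:
  assumes M: "M \<in> submat X Y" and N: "N \<in> submat Y Z"
  shows "compose X (mult_fun V Z) (compose X (push_fun V Y (mat_fun Y N)) (mat_fun X M))
    = mat_fun X (mat_mult M N)"
proof
  fix x
  let ?g = "mat_fun Y N"
  show "compose X (mult_fun V Z) (compose X (push_fun V Y ?g) (mat_fun X M)) x = mat_fun X (mat_mult M N) x"
  proof (cases "x \<in> X")
    case True
    have p: "M x \<in> subdist Y" by (rule submat_row[OF M])
    have g: "fun_mat Y ?g \<in> submat Y (usubdist V Z)"
      using mat_fun_funcset[OF N] by (intro fun_mat_submat) (auto simp: PiE_iff)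
    let ?\<sigma> = "vec_mat (M x) (fun_mat Y ?g)"
    have \<sigma>: "?\<sigma> \<in> subdist (usubdist V Z)" by (rule vec_mat_subdist[OF p g])
    have push: "push_fun V Y ?g (mat_fun X M x) = udist V ?\<sigma>"
      using True
      by (simp add: push_fun_def mat_fun_def[of X] udist_usubdist[OF p] the_dist_udist[OF p] Let_def
          flip: vec_mat_fun_mat[OF p])
    \<comment> \<open>Here \<open>the_dist V\<close> is read as a matrix whose row at a code is the
      encoded subdistribution. Its rows at other indices are uncontrolled, which
      \<open>vec_mat_assoc\<close> permits.\<close>
    have "vec_mat ?\<sigma> (the_dist V) = vec_mat (M x) (mat_mult (fun_mat Y ?g) (the_dist V))"
      by (rule vec_mat_assoc[OF subdist_finite[OF p] subdist_finite[OF submat_row[OF g]]])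
    also have "\<dots> = vec_mat (M x) N"
      using subdist_supp[OF p]
      by (auto simp: vec_mat_def fun_mat_mult mat_fun_def the_dist_udist[OF submat_row[OF N]]
          fun_eq_iff intro!: sum.cong)
    finally have "mult_fun V Z (udist V ?\<sigma>) = udist V (vec_mat (M x) N)"
      by (simp add: mult_fun_def udist_usubdist[OF \<sigma>] the_dist_udist[OF \<sigma>] vec_mat_def[of ?\<sigma>])
    then show ?thesis
      using True push by (simp add: compose_def mat_fun_def[of X "mat_mult M N"] mat_mult_row)
  qed (simp add: compose_def mat_fun_def)
qed

lemma kleisli_tensor_mat:
  assumes M: "M \<in> submat X Y" and M': "M' \<in> submat X' Y'"
  shows "compose (uprod V X X') (str_fun V Y Y') (prod_fun V X X' (mat_fun X M) (mat_fun X' M'))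
    = mat_fun (uprod V X X') (kron V M M')"
proof
  fix w
  show "compose (uprod V X X') (str_fun V Y Y') (prod_fun V X X' (mat_fun X M) (mat_fun X' M')) w
    = mat_fun (uprod V X X') (kron V M M') w"
  proof (cases "w \<in> uprod V X X'")
    case True
    then obtain x u where "w = upair V (x, u)" "x \<in> X" "u \<in> X'" by (rule uprodE)
    then show ?thesis
      using submat_row[OF M, of x] submat_row[OF M', of u]
      by (simp add: compose_def prod_fun_def str_fun_def mat_fun_def udist_usubdist the_dist_udist
          vec_kron_def Let_def cong: if_cong)
  qed (simp add: compose_def mat_fun_def)
qed

definition kleisli_to_mat ::
  "('o \<Rightarrow> 'u set) \<Rightarrow> ('o, 'u \<Rightarrow> 'u) arrow \<times> 'o \<Rightarrow> ('o, 'u \<Rightarrow> 'u \<Rightarrow> real) arrow" where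
  "kleisli_to_mat U = (\<lambda>(a, B). Arrow (asrc a) (fun_rows (U (asrc a)) (amap a)) B)"

text \<open>The parameter \<open>D\<close> is the object part of the monad; it supplies the codomain
  of the underlying arrow, while the Kleisli target is recorded in the second component.\<close>

definition mat_to_kleisli ::
  "('o \<Rightarrow> 'u set) \<Rightarrow> ('o \<Rightarrow> 'o) \<Rightarrow> ('o, 'u \<Rightarrow> 'u \<Rightarrow> real) arrow \<Rightarrow> ('o, 'u \<Rightarrow> 'u) arrow \<times> 'o" where
  "mat_to_kleisli U D a = (Arrow (asrc a) (mat_fun (U (asrc a)) (amap a)) (D (atgt a)), atgt a)"

lemma kleisli_to_mat_Arrow [simp]:
  "kleisli_to_mat U (Arrow A f B', B) = Arrow A (fun_rows (U A) f) B"
  by (simp add: kleisli_to_mat_def)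

lemma mat_to_kleisli_Arrow [simp]:
  "mat_to_kleisli U D (Arrow A M B) = (Arrow A (mat_fun (U A) M) (D B), B)"
  by (simp add: mat_to_kleisli_def)

section \<open>The two instances of the matrix construction\<close>

lemma subMat_mat_cat: "subMat V = mat_cat (usets V) (\<lambda>X. X) (\<lambda>_ _ _. True)"
  by (simp add: subMat_def mat_cat_def)

lemma psubMat_mat_cat: "psubMat V = mat_cat (pSet_ob V) fst partitioned"
  by (simp add: psubMat_def mat_cat_def)

lemma matrix_structure_set:
  "matrix_structure V (usets V) (\<lambda>X. X) (\<lambda>_ _ _. True) (uprod V) {upoint V}"
  by unfold_locales (simp_all add: uprod_usets upoint_usets)

lemma matrix_structure_pset:
  "matrix_structure V (pSet_ob V) fst partitioned (pprod V) (pone V)"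
proof -
  have fun_partitioned: "partitioned A B (fun_mat X f)"
    if "A \<in> pSet_ob V" "B \<in> pSet_ob V" "X = fst A"
      "\<And>x x'. (x, x') \<in> snd A \<Longrightarrow> (f x, f x') \<in> snd B" for A B X f
    using that by (simp add: pSet_ob_iff partitioned_fun_mat)
  \<comment> \<open>Structure functions such as \<open>assoc_fun\<close> are restricted to their
    domains, so evaluating them at related points requires membership.\<close>
  have mem: "x \<in> fst A" "x' \<in> fst A" if "A \<in> pSet_ob V" "(x, x') \<in> snd A" for A x x'
    using that equiv_type by (fastforce simp: pSet_ob_iff)+
  show ?thesis
  proof
    fix A B C assume o: "A \<in> pSet_ob V" "B \<in> pSet_ob V" "C \<in> pSet_ob V"
    show "partitioned (pprod V (pprod V A B) C) (pprod V A (pprod V B C))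
        (fun_mat (uprod V (uprod V (fst A) (fst B)) (fst C)) (assoc_fun V (fst A) (fst B) (fst C)))"
      by (rule fun_partitioned)
        (simp_all add: o pprod_ob, auto simp: pprod_def assoc_fun_def mem[OF o(1)] mem[OF o(2)] mem[OF o(3)] elim!: uprod_relE)
    show "partitioned (pprod V A (pprod V B C)) (pprod V (pprod V A B) C)
        (fun_mat (uprod V (fst A) (uprod V (fst B) (fst C))) (assoc_inv_fun V))"
      by (rule fun_partitioned) (simp_all add: o pprod_ob, auto simp: pprod_def assoc_inv_fun_def elim!: uprod_relE)
  next
    fix A assume o: "A \<in> pSet_ob V"
    show "partitioned (pprod V (pone V) A) A (fun_mat (uprod V {upoint V} (fst A)) (left_fun V (fst A)))"
      by (rule fun_partitioned)
        (simp_all add: o pprod_ob pone_ob, auto simp: pprod_def pone_def left_fun_def mem[OF o] elim!: uprod_relE)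
    show "partitioned A (pprod V (pone V) A) (fun_mat (fst A) (\<lambda>x. upair V (upoint V, x)))"
      by (rule fun_partitioned) (simp_all add: o pprod_ob pone_ob, auto simp: pprod_def pone_def)
    show "partitioned (pprod V A (pone V)) A (fun_mat (uprod V (fst A) {upoint V}) (right_fun V (fst A)))"
      by (rule fun_partitioned)
        (simp_all add: o pprod_ob pone_ob, auto simp: pprod_def pone_def right_fun_def mem[OF o] elim!: uprod_relE)
    show "partitioned A (pprod V A (pone V)) (fun_mat (fst A) (\<lambda>x. upair V (x, upoint V)))"
      by (rule fun_partitioned) (simp_all add: o pprod_ob pone_ob, auto simp: pprod_def pone_def)
  next
    show "fst (pprod V A B) = uprod V (fst A) (fst B)" for A B by (simp add: pprod_def)
    show "fst (pone V) = {upoint V}" by (simp add: pone_def)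
  qed (simp_all add: pprod_ob pone_ob partitioned_id partitioned_mult, simp add: partitioned_kron pSet_ob_iff)
qed

section \<open>Morphisms and structure of the Kleisli categories\<close>

lemma Arrow_hom_Kl_D:
  "(Arrow X' f Y'', Y') \<in> hom (Kl_D V) X Y \<longleftrightarrow> X' = X \<and> Y' = Y \<and> Y'' = usubdist V Y \<and>
     X \<in> usets V \<and> Y \<in> usets V \<and> f \<in> X \<rightarrow>\<^sub>E usubdist V Y"
  by (auto simp: hom_def Kleisli_def Set_cat_def Set_D_def usubdist_usets)

lemma hom_Kl_DE:
  assumes "k \<in> hom (Kl_D V) X Y"
  obtains f where "k = (Arrow X f (usubdist V Y), Y)" "X \<in> usets V" "Y \<in> usets V"
    "f \<in> X \<rightarrow>\<^sub>E usubdist V Y"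
  using assms by (cases k; cases "fst k") (auto simp: Arrow_hom_Kl_D)

text \<open>The arrow conditions of the two partitioned categories meet here: relating the values of
  \<open>f\<close> means that its decoded rows are equivalent, which is the row criterion.\<close>

lemma respects_psubdist_iff:
  assumes A: "A \<in> pSet_ob V" and f: "f \<in> fst A \<rightarrow>\<^sub>E usubdist V (fst B)"
  shows "(\<forall>(x, x')\<in>snd A. (f x, f x') \<in> snd (psubdist V B)) \<longleftrightarrow> partitioned A B (fun_rows (fst A) f)"
proof -
  have eq: "equiv (fst A) (snd A)" using A by (simp add: pSet_ob_iff)
  have "(f x, f x') \<in> snd (psubdist V B)
      \<longleftrightarrow> sub_equiv B (fun_rows (fst A) f x) (fun_rows (fst A) f x')" if "(x, x') \<in> snd A" for x x'
  proof -
    have "x \<in> fst A" "x' \<in> fst A" using that equiv_type[OF eq] by auto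
    then show ?thesis using f by (auto simp: psubdist_rel fun_rows_def)
  qed
  then show ?thesis
    using partitioned_iff_rows[OF eq fun_rows_submat[OF f], of B] by auto
qed

lemma Arrow_hom_Kl_pD:
  "(Arrow A' f B'', B') \<in> hom (Kl_pD V) A B \<longleftrightarrow> A' = A \<and> B' = B \<and> B'' = psubdist V B \<and>
     A \<in> pSet_ob V \<and> B \<in> pSet_ob V \<and> f \<in> fst A \<rightarrow>\<^sub>E usubdist V (fst B) \<and>
     partitioned A B (fun_rows (fst A) f)"
proof -
  have "(Arrow A' f B'', B') \<in> hom (Kl_pD V) A B \<longleftrightarrow> A' = A \<and> B' = B \<and> B'' = psubdist V B \<and>
     A \<in> pSet_ob V \<and> B \<in> pSet_ob V \<and> f \<in> fst A \<rightarrow>\<^sub>E fst (psubdist V B) \<and>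
     (\<forall>(x, x')\<in>snd A. (f x, f x') \<in> snd (psubdist V B))"
    using psubdist_ob[of B]
    by (simp add: hom_def Kleisli_def pSet_cat_def pSet_D_def del: split_paired_Ex) metis
  moreover have "fst (psubdist V B) = usubdist V (fst B)" by (simp add: psubdist_def)
  ultimately show ?thesis
    using respects_psubdist_iff[of A f B] by metis
qed

lemma hom_Kl_pDE:
  assumes "k \<in> hom (Kl_pD V) A B"
  obtains f where "k = (Arrow A f (psubdist V B), B)" "A \<in> pSet_ob V" "B \<in> pSet_ob V"
    "f \<in> fst A \<rightarrow>\<^sub>E usubdist V (fst B)" "partitioned A B (fun_rows (fst A) f)"
proof -
  obtain A' f B'' B' where "k = (Arrow A' f B'', B')"
    by (metis arrow.exhaust surj_pair)
  then show ?thesis using assms that by (simp add: Arrow_hom_Kl_pD)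
qed

lemma Kl_D_simps:
  "Ob (Kl_D V) = usets V"
  "Id (Kl_D V) X = (Arrow X (mat_fun X (mat_id X)) (usubdist V X), X)"
  "Cmp (Kl_D V) (Arrow X f Y', Y) (Arrow Y f' Z', Z)
    = (Arrow X (compose X (mult_fun V Z) (compose X (push_fun V Y f') f)) (usubdist V Z), Z)"
  by (simp_all add: Kleisli_def Set_cat_def Set_D_def unit_fun_mat)

text \<open>The constraints are expressed through \<open>mat_to_kleisli\<close>, as
  \<open>transported_monoidal\<close> demands; \<open>unit_fun_comp\<close> justifies this
  form.\<close>

lemma Kl_D_tensor_simps:
  "tob (Kl_D_tensor V) = uprod V"
  "tunit (Kl_D_tensor V) = {upoint V}"
  "tar (Kl_D_tensor V) (Arrow X f Y0, Y) (Arrow X' f' Y0', Y')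
    = (Arrow (uprod V X X') (compose (uprod V X X') (str_fun V Y Y') (prod_fun V X X' f f'))
         (usubdist V (uprod V Y Y')), uprod V Y Y')"
  "tassoc (Kl_D_tensor V) X Y Z = mat_to_kleisli (\<lambda>X. X) (usubdist V)
    (tassoc (mat_tensor V (\<lambda>X. X) (uprod V) {upoint V}) X Y Z)"
  "tleft (Kl_D_tensor V) X = mat_to_kleisli (\<lambda>X. X) (usubdist V)
    (tleft (mat_tensor V (\<lambda>X. X) (uprod V) {upoint V}) X)"
  "tright (Kl_D_tensor V) X = mat_to_kleisli (\<lambda>X. X) (usubdist V)
    (tright (mat_tensor V (\<lambda>X. X) (uprod V) {upoint V}) X)"
  by (simp_all add: Kleisli_tensor_def Set_cat_def Set_prod_def Set_D_def mat_tensor_def Let_def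
      unit_fun_comp[OF structure_fun_maps(1)] unit_fun_comp[OF structure_fun_maps(2)]
      unit_fun_comp[OF structure_fun_maps(3)])

lemma Kl_pD_simps:
  "Ob (Kl_pD V) = pSet_ob V"
  "Id (Kl_pD V) A = (Arrow A (mat_fun (fst A) (mat_id (fst A))) (psubdist V A), A)"
  "Cmp (Kl_pD V) (Arrow A f B', B) (Arrow B f' C', C)
    = (Arrow A (compose (fst A) (mult_fun V (fst C)) (compose (fst A) (push_fun V (fst B) f') f))
         (psubdist V C), C)"
  by (simp_all add: Kleisli_def pSet_cat_def pSet_D_def unit_fun_mat)

lemma Kl_pD_tensor_simps:
  "tob (Kl_pD_tensor V) = pprod V"
  "tunit (Kl_pD_tensor V) = pone V"
  "tar (Kl_pD_tensor V) (Arrow A f B0, B) (Arrow A' f' B0', B')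
    = (Arrow (pprod V A A') (compose (uprod V (fst A) (fst A')) (str_fun V (fst B) (fst B'))
         (prod_fun V (fst A) (fst A') f f')) (psubdist V (pprod V B B')), pprod V B B')"
  "tassoc (Kl_pD_tensor V) A B C = mat_to_kleisli fst (psubdist V)
    (tassoc (mat_tensor V fst (pprod V) (pone V)) A B C)"
  "tleft (Kl_pD_tensor V) A = mat_to_kleisli fst (psubdist V)
    (tleft (mat_tensor V fst (pprod V) (pone V)) A)"
  "tright (Kl_pD_tensor V) A = mat_to_kleisli fst (psubdist V)
    (tright (mat_tensor V fst (pprod V) (pone V)) A)"
  by (simp_all add: Kleisli_tensor_def pSet_cat_def pSet_prod_def pSet_D_def mat_tensor_def Let_def
      pprod_def[of V] pone_def
      unit_fun_comp[OF structure_fun_maps(1)] unit_fun_comp[OF structure_fun_maps(2)]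
      unit_fun_comp[OF structure_fun_maps(3)])

lemma transported_set:
  "transported_monoidal (subMat V) (mat_tensor V (\<lambda>X. X) (uprod V) {upoint V}) (Kl_D V) (Kl_D_tensor V)
     (kleisli_to_mat (\<lambda>X. X)) (mat_to_kleisli (\<lambda>X. X) (usubdist V))"
proof -
  interpret M: matrix_structure V "usets V" "\<lambda>X. X" "\<lambda>_ _ _. True" "uprod V" "{upoint V}"
    by (rule matrix_structure_set)
  interpret C: monoidal_category "mat_cat (usets V) (\<lambda>X. X) (\<lambda>_ _ _. True)"
      "mat_tensor V (\<lambda>X. X) (uprod V) {upoint V}"
    by (rule M.monoidal_C)
  show ?thesis
    unfolding subMat_mat_cat
    \<comment> \<open>The interpretation \<open>C\<close> discharges the monoidal laws; the goals
      left are \<open>Ob_K\<close> to \<open>tright_K\<close>, in the order of the locale.\<close>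
    apply unfold_locales
    subgoal by (simp add: Kl_D_simps)
    subgoal by (elim hom_Kl_DE) (simp add: M.Arrow_hom fun_rows_submat)
    subgoal by (elim M.homE) (simp add: Arrow_hom_Kl_D mat_fun_funcset fun_rows_mat_fun)
    subgoal by (elim M.homE) (simp add: fun_rows_mat_fun)
    subgoal by (elim hom_Kl_DE) (simp add: mat_fun_fun_rows)
    subgoal by (simp add: Kl_D_simps)
    subgoal by (elim M.homE) (simp add: Kl_D_simps kleisli_comp_mat)
    subgoal by (simp add: Kl_D_tensor_simps)
    subgoal by (simp add: Kl_D_tensor_simps)
    subgoal by (elim M.homE) (simp add: Kl_D_tensor_simps kleisli_tensor_mat)
    subgoal by (simp only: Kl_D_tensor_simps)
    subgoal by (simp only: Kl_D_tensor_simps)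
    subgoal by (simp only: Kl_D_tensor_simps)
    done
qed

lemma transported_pset:
  "transported_monoidal (psubMat V) (mat_tensor V fst (pprod V) (pone V)) (Kl_pD V) (Kl_pD_tensor V)
     (kleisli_to_mat fst) (mat_to_kleisli fst (psubdist V))"
proof -
  interpret M: matrix_structure V "pSet_ob V" fst partitioned "pprod V" "pone V"
    by (rule matrix_structure_pset)
  interpret C: monoidal_category "mat_cat (pSet_ob V) fst partitioned" "mat_tensor V fst (pprod V) (pone V)"
    by (rule M.monoidal_C)
  show ?thesis
    unfolding psubMat_mat_cat
    apply unfold_locales
    subgoal by (simp add: Kl_pD_simps)
    subgoal by (elim hom_Kl_pDE) (simp add: M.Arrow_hom fun_rows_submat)
    subgoal by (elim M.homE) (simp add: Arrow_hom_Kl_pD mat_fun_funcset fun_rows_mat_fun)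
    subgoal by (elim M.homE) (simp add: fun_rows_mat_fun)
    subgoal by (elim hom_Kl_pDE) (simp add: mat_fun_fun_rows)
    subgoal by (simp add: Kl_pD_simps)
    subgoal by (elim M.homE) (simp add: Kl_pD_simps kleisli_comp_mat)
    subgoal by (simp add: Kl_pD_tensor_simps)
    subgoal by (simp add: Kl_pD_tensor_simps)
    subgoal by (elim M.homE) (simp add: Kl_pD_tensor_simps kleisli_tensor_mat M.U_P)
    subgoal by (simp only: Kl_pD_tensor_simps)
    subgoal by (simp only: Kl_pD_tensor_simps)
    subgoal by (simp only: Kl_pD_tensor_simps)
    done
qed

section \<open>Terminal objects\<close>

lemma funcset_singleton: "f \<in> X \<rightarrow>\<^sub>E {c} \<longleftrightarrow> f = (\<lambda>x\<in>X. c)"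
  by (auto simp: PiE_iff extensional_def fun_eq_iff)

lemma terminal_set: "terminal_in (Set_cat V) {upoint V}"
  unfolding terminal_in_def
proof (intro conjI ballI)
  show "{upoint V} \<in> Ob (Set_cat V)" by (simp add: Set_cat_def upoint_usets)
  fix X assume X: "X \<in> Ob (Set_cat V)"
  have "f \<in> hom (Set_cat V) X {upoint V} \<longleftrightarrow> f = Arrow X (\<lambda>x\<in>X. upoint V) {upoint V}" for f
    using X by (cases f) (auto simp: hom_def Set_cat_def upoint_usets funcset_singleton)
  then show "\<exists>!f. f \<in> hom (Set_cat V) X {upoint V}" by auto
qed

lemma terminal_pset: "terminal_in (pSet_cat V) (pone V)"
  unfolding terminal_in_def
proof (intro conjI ballI)
  show "pone V \<in> Ob (pSet_cat V)" by (simp add: pSet_cat_def pone_ob)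
  fix A assume A: "A \<in> Ob (pSet_cat V)"
  then have rel: "x \<in> fst A" "x' \<in> fst A" if "(x, x') \<in> snd A" for x x'
    using that equiv_type by (fastforce simp: pSet_cat_def pSet_ob_iff)+
  have "f \<in> hom (pSet_cat V) A (pone V) \<longleftrightarrow> f = Arrow A (\<lambda>x\<in>fst A. upoint V) (pone V)" for f
  proof (cases f)
    case (Arrow A' g B')
    have "(\<forall>(x, x')\<in>snd A. ((\<lambda>x\<in>fst A. upoint V) x, (\<lambda>x\<in>fst A. upoint V) x') \<in> snd (pone V))"
      using rel by (auto simp: pone_def)
    moreover have "fst (pone V) = {upoint V}" by (simp add: pone_def)
    ultimately show ?thesis
      using A pone_ob Arrow
      by (auto simp: hom_def pSet_cat_def funcset_singleton simp del: split_paired_Ex)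
  qed
  then show "\<exists>!f. f \<in> hom (pSet_cat V) A (pone V)" by auto
qed

end

theorem proposition5p25:
  fixes V :: "'u universe"
  assumes "set_universe V"
  shows
    "(\<exists>F G \<eta> \<epsilon>.
        equivalence (Kl_D V) (subMat V) F G \<eta> \<epsilon> \<and>
        (\<exists>T \<phi> \<iota>.
           strong_monoidal_functor (Kl_D V) (Kl_D_tensor V) (subMat V) T F \<phi> \<iota> \<and>
           (\<forall>X\<in>Ob (subMat V). \<forall>Y\<in>Ob (subMat V). tob T X Y = uprod V X Y) \<and>
           (\<forall>X M Y X' M' Y'. Arrow X M Y \<in> Ar (subMat V) \<and> Arrow X' M' Y' \<in> Ar (subMat V) \<longrightarrow>
              tar T (Arrow X M Y) (Arrow X' M' Y') =
                Arrow (uprod V X X') (kron V M M') (uprod V Y Y')) \<and>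
           tunit T = {upoint V})) \<and>
     terminal_in (Set_cat V) {upoint V} \<and>
     (\<exists>F G \<eta> \<epsilon>.
        equivalence (Kl_pD V) (psubMat V) F G \<eta> \<epsilon> \<and>
        (\<exists>T \<phi> \<iota>.
           strong_monoidal_functor (Kl_pD V) (Kl_pD_tensor V) (psubMat V) T F \<phi> \<iota> \<and>
           (\<forall>A\<in>Ob (psubMat V). \<forall>B\<in>Ob (psubMat V). tob T A B = pprod V A B) \<and>
           (\<forall>A M B A' M' B'. Arrow A M B \<in> Ar (psubMat V) \<and> Arrow A' M' B' \<in> Ar (psubMat V) \<longrightarrow>
              tar T (Arrow A M B) (Arrow A' M' B') =
                Arrow (pprod V A A') (kron V M M') (pprod V B B')) \<and>
           tunit T = pone V)) \<and>
     terminal_in (pSet_cat V) (pone V)"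
proof -
  interpret set_universe V by (rule assms)
  interpret S: transported_monoidal "subMat V" "mat_tensor V (\<lambda>X. X) (uprod V) {upoint V}" "Kl_D V"
      "Kl_D_tensor V" "kleisli_to_mat (\<lambda>X. X)" "mat_to_kleisli (\<lambda>X. X) (usubdist V)"
    by (rule transported_set)
  interpret P: transported_monoidal "psubMat V" "mat_tensor V fst (pprod V) (pone V)" "Kl_pD V"
      "Kl_pD_tensor V" "kleisli_to_mat fst" "mat_to_kleisli fst (psubdist V)"
    by (rule transported_pset)
  let ?S = "mat_tensor V (\<lambda>X. X) (uprod V) {upoint V}" and ?P = "mat_tensor V fst (pprod V) (pone V)"
  have S: "tob ?S = uprod V" "tunit ?S = {upoint V}"
    "tar ?S (Arrow X M Y) (Arrow X' M' Y') = Arrow (uprod V X X') (kron V M M') (uprod V Y Y')"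
    for X M Y X' M' Y'
    by (simp_all add: mat_tensor_def)
  have P: "tob ?P = pprod V" "tunit ?P = pone V"
    "tar ?P (Arrow A M B) (Arrow A' M' B') = Arrow (pprod V A A') (kron V M M') (pprod V B B')"
    for A M B A' M' B'
    by (simp_all add: mat_tensor_def)
  \<comment> \<open>Unification with the transport lemmas supplies the witnesses: \<open>F\<close>
    is the transport functor in both the equivalence and the monoidal statement, and
    \<open>T\<close> is \<open>mat_tensor\<close>.\<close>
  show ?thesis
    by (intro conjI terminal_set terminal_pset;
        ((rule exI)+, rule conjI, (rule S.equivalence_transport P.equivalence_transport),
         (rule exI)+, rule conjI, (rule S.strong_monoidal_transport P.strong_monoidal_transport)))
      (simp_all add: S P)
qed

end
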